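(* Let $\mathcal P$ be graph connectivity ($\mathcal P(G)=0$ if $G$ is disconnected, $\mathcal P(G)=1$ otherwise). For each $n$ let $d=d(n)$ with $d\to\infty$ as $n\to\infty$, let $s=s(n)$ and $\theta=\theta(n)$, and let $\mathcal R_s=\{G_{\boldsymbol w}:\operatorname{maxdeg}(G)\le s\}$. Let $s,n,d$ be sufficiently large (i.e. larger than an absolute constant), and suppose that $\theta\ge\frac{3}{2\lfloor s/4\rfloor-2}$ and that there exists $\kappa>1$ (not depending on $n$) such that $$\theta>\frac{2\log\frac{\kappa sn}{\log(ds)}}{s-16}.$$ Then $\liminf_{n\to\infty}R_n(\mathcal P,\mathcal R_s,\theta)=1$.
   Context: Graphs are simple with vertex set $[d]=\{1,\dots,d\}$; $\mathcal G_d$ is the set of all of them; $\operatorname{maxdeg}(G)$ is the maximum degree. $\mathcal G_i=\{G\in\mathcal G_d:\mathcal P(G)=i\}$, $i=0,1$. Model (both signs of interaction allowed): for $\theta\ge0$, a graph $G$ on $[d]$ and $\boldsymbol w\in\{\pm1\}^{\binom d2}$, $\mathbb P_{\theta,G_{\boldsymbol w}}(\boldsymbol X=\boldsymbol x)\propto\exp\big(\theta\sum_{(u,v)\in E(G)}w_{uv}x_ux_v\big)$, $\boldsymbol x\in\{\pm1\}^d$; $\mathbb P^{\otimes n}_{\theta,G_{\boldsymbol w}}$ is the law of $n$ i.i.d. observations. Minimax risk: $$R_n(\mathcal P,\mathcal R,\theta)=\inf_\psi\Big[\sup_{\boldsymbol w}\sup_{G\in\mathcal G_0\cap\mathcal R}\mathbb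 P^{\otimes n}_{\theta,G_{\boldsymbol w}}(\psi=1)+\sup_{\boldsymbol w}\sup_{G\in\mathcal G_1\cap\mathcal R}\mathbb P^{\otimes n}_{\theta,G_{\boldsymbol w}}(\psi=0)\Big],$$ where the infimum is over measurable $\{0,1\}$-valued tests $\psi$ of the $n$ observations, the suprema over $\boldsymbol w$ are over $\{\pm1\}^{\binom d2}$, and $\mathcal R$ restricts the graph $G$ (here: $\operatorname{maxdeg}(G)\le s$).
   Formalization: The formal theorem assumes in addition that s ≤ d for all large n; without it the claim fails, e.g. for n ≈ d³, s ≈ 100 d log d, θ = 0.2/d, where the degree bound is void and the graph can be recovered. *)

theory Defs
  imports "HOL-Probability.Probability"
begin

text \<open>A simple graph on the vertex set \<open>{1..d}\<close> is identified with its set of edges, an edge being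
  a two-element set of vertices.\<close>

type_synonym graph = "nat set set"

definition vertex_pairs :: "nat \<Rightarrow> nat set set" where
  "vertex_pairs d = {e. e \<subseteq> {1..d} \<and> card e = 2}"

definition graphs :: "nat \<Rightarrow> graph set" where
  "graphs d = Pow (vertex_pairs d)"

definition degree :: "graph \<Rightarrow> nat \<Rightarrow> nat" where
  "degree G v = card {e \<in> G. v \<in> e}"

text \<open>Only meaningful for \<open>d \<ge> 1\<close>.\<close>

definition maxdeg :: "nat \<Rightarrow> graph \<Rightarrow> nat" where
  "maxdeg d G = Max (degree G ` {1..d})"

definition connected_graph :: "nat \<Rightarrow> graph \<Rightarrow> bool" where
  "connected_graph d G \<longleftrightarrow> (\<forall>u\<in>{1..d}. \<forall>v\<in>{1..d}. (u, v) \<in> {(a, b). {a, b} \<in> G}\<^sup>*)"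

definition connectivity :: "nat \<Rightarrow> graph \<Rightarrow> nat" where
  "connectivity d G = (if connected_graph d G then 1 else 0)"

definition max_degree_class :: "nat \<Rightarrow> nat \<Rightarrow> graph set" where
  "max_degree_class d s = {G \<in> graphs d. maxdeg d G \<le> s}"

definition spins :: "nat \<Rightarrow> (nat \<Rightarrow> real) set" where
  "spins d = {1..d} \<rightarrow>\<^sub>E {-1, 1}"

definition edge_signs :: "nat \<Rightarrow> (nat set \<Rightarrow> real) set" where
  "edge_signs d = vertex_pairs d \<rightarrow>\<^sub>E {-1, 1}"

text \<open>For an edge \<open>e = {u, v}\<close> the product \<open>\<Prod>i\<in>e. x i\<close> is \<open>x u * x v\<close>.\<close>

definition ising_weight :: "real \<Rightarrow> graph \<Rightarrow> (nat set \<Rightarrow> real) \<Rightarrow> (nat \<Rightarrow> real) \<Rightarrow> real" where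
  "ising_weight \<theta> G w x = exp (\<theta> * (\<Sum>e\<in>G. w e * (\<Prod>i\<in>e. x i)))"

definition ising :: "nat \<Rightarrow> real \<Rightarrow> graph \<Rightarrow> (nat set \<Rightarrow> real) \<Rightarrow> (nat \<Rightarrow> real) measure" where
  "ising d \<theta> G w = point_measure (spins d)
     (\<lambda>x. ennreal (ising_weight \<theta> G w x / (\<Sum>y\<in>spins d. ising_weight \<theta> G w y)))"

definition ising_sample ::
    "nat \<Rightarrow> nat \<Rightarrow> real \<Rightarrow> graph \<Rightarrow> (nat set \<Rightarrow> real) \<Rightarrow> (nat \<Rightarrow> nat \<Rightarrow> real) measure" where
  "ising_sample n d \<theta> G w = PiM {..<n} (\<lambda>_. ising d \<theta> G w)"

definition tests :: "nat \<Rightarrow> nat \<Rightarrow> ((nat \<Rightarrow> nat \<Rightarrow> real) \<Rightarrow> nat) set" where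
  "tests n d = measurable (PiM {..<n} (\<lambda>_. count_space (spins d))) (count_space {0, 1})"

text \<open>The risk is taken in \<^typ>\<open>ennreal\<close>, so that all suprema and infima are those of a complete
  lattice; a supremum over an empty class of graphs is \<open>0\<close>.\<close>

definition type_I_risk ::
    "(graph \<Rightarrow> nat) \<Rightarrow> graph set \<Rightarrow> nat \<Rightarrow> nat \<Rightarrow> real \<Rightarrow> ((nat \<Rightarrow> nat \<Rightarrow> real) \<Rightarrow> nat) \<Rightarrow> ennreal" where
  "type_I_risk P R n d \<theta> \<psi> =
     (SUP w\<in>edge_signs d. SUP G\<in>{G \<in> graphs d. P G = 0} \<inter> R.
        emeasure (ising_sample n d \<theta> G w) {X \<in> space (ising_sample n d \<theta> G w). \<psi> X = 1})"

definition type_II_risk ::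
    "(graph \<Rightarrow> nat) \<Rightarrow> graph set \<Rightarrow> nat \<Rightarrow> nat \<Rightarrow> real \<Rightarrow> ((nat \<Rightarrow> nat \<Rightarrow> real) \<Rightarrow> nat) \<Rightarrow> ennreal" where
  "type_II_risk P R n d \<theta> \<psi> =
     (SUP w\<in>edge_signs d. SUP G\<in>{G \<in> graphs d. P G = 1} \<inter> R.
        emeasure (ising_sample n d \<theta> G w) {X \<in> space (ising_sample n d \<theta> G w). \<psi> X = 0})"

definition minimax_risk ::
    "(graph \<Rightarrow> nat) \<Rightarrow> graph set \<Rightarrow> nat \<Rightarrow> nat \<Rightarrow> real \<Rightarrow> ennreal" where
  "minimax_risk P R n d \<theta> = (INF \<psi>\<in>tests n d. type_I_risk P R n d \<theta> \<psi> + type_II_risk P R n d \<theta> \<psi>)"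

end

theory Submission
  imports Defs "HOL-Real_Asymp.Real_Asymp"
begin

text \<open>
  Both signs of interaction make it possible to attach a dense part of a graph to the rest almost
  invisibly. Take a clique on \<open>s - 1\<close> vertices with positive interactions and an outside vertex, the hub,
  joined to two clique vertices, the ports, by one positive and one negative edge. The two edges
  contribute \<open>\<theta> x\<^sub>h (x\<^sub>p - x\<^sub>q)\<close> to the exponent, which vanishes unless the ports disagree, and
  inside the clique disagreement is exponentially unlikely.

  The connected graph of the lower bound is a path, the spine, with \<open>M = d div s\<close> cliques attached in this way to
  distinct spine vertices; the spine also absorbs the vertices left over by the division. The \<open>j\<close>-th
  disconnected graph omits the two edges of clique \<open>j\<close>. By the global flip symmetry of a clique, its link
  multiplies the partition function by a factor \<open>r\<close> that does not depend on which other links are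
  present. Hence the likelihood ratios of two different disconnected graphs against the connected
  one are uncorrelated, while each has second moment \<open>r\<^sup>2\<close>. The chi-square divergence of the uniform
  mixture of the \<open>n\<close>-fold products from the connected law is therefore at most \<open>(r\<^sup>2\<^sup>n - 1) / M\<close>, and the
  risk is at least one minus its square root (\<open>le_cam_iid_mixture\<close>, \<open>minimax_risk_ge\<close>).

  Two estimates remain. First, \<open>r\<^sup>2 \<le> 1 + 8 exp (- \<theta> (s - 16) / 2)\<close> for large \<open>s\<close> (\<open>chi_square_of_link\<close>):
  \<open>r - 1\<close> is at most \<open>cosh (2 \<theta>) - 1\<close> times the probability that the ports disagree. If \<open>\<theta> s \<le> 2 ln s\<close>
  the first factor, of order \<open>\<theta>\<^sup>2\<close>, is already small enough; if \<open>\<theta> s > 2 ln s\<close> the second one, at most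
  \<open>2 s exp (- \<theta> (s - 1))\<close>, outweighs the growth of the first. Secondly, the lower bound on \<open>\<theta>\<close> turns this into \<open>r\<^sup>2\<^sup>n \<le> exp y\<close> with
  \<open>y = 8 ln (d s) / s\<close>, and \<open>(exp y - 1) / M\<close> tends to zero uniformly in \<open>s\<close>
  (\<open>exponential_moment_le_gap\<close>): for \<open>s \<le> sqrt d\<close> there are at least \<open>sqrt d / 2\<close> cliques while \<open>exp y\<close> is at most
  \<open>d\<^sup>1\<^sup>/\<^sup>4\<close>, and for \<open>s > sqrt d\<close> the exponent \<open>y\<close> itself tends to zero. The constant test
  shows that the risk never exceeds one.
\<close>

section \<open>Le Cam's bound for a finite mixture\<close>

text \<open>A test errs against the mixture \<open>q\<close> of the \<open>Q j\<close> or against \<open>P\<close> with total probability at least one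
  minus their total variation distance, which the Cauchy-Schwarz inequality bounds by the square
  root of the chi-square divergence \<open>\<Sum> q\<^sup>2 / P - 1\<close>. After expanding \<open>q\<^sup>2\<close> into pairs, the subtracted \<open>1\<close> absorbs the
  off-diagonal terms, and the diagonal keeps the weight \<open>1 / card J\<close>. Some \<open>Q j\<close> is at least as bad as the average.\<close>

lemma le_cam_mixture:
  fixes P :: "'a \<Rightarrow> real" and Q :: "'j \<Rightarrow> 'a \<Rightarrow> real"
  assumes S: "finite S" and J: "finite J" "J \<noteq> {}"
    and P: "\<And>x. x \<in> S \<Longrightarrow> P x > 0" "sum P S = 1"
    and Q: "\<And>j. j \<in> J \<Longrightarrow> sum (Q j) S = 1"
    and off: "\<And>j k. j \<in> J \<Longrightarrow> k \<in> J \<Longrightarrow> j \<noteq> k \<Longrightarrow> (\<Sum>x\<in>S. Q j x * Q k x / P x) \<le> 1"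
    and diag: "\<And>j. j \<in> J \<Longrightarrow> (\<Sum>x\<in>S. Q j x * Q j x / P x) \<le> R"
    and A: "A \<subseteq> S"
  shows "\<exists>j\<in>J. 1 - sqrt ((R - 1) / card J) \<le> sum (Q j) A + sum P (S - A)"
proof -
  define M where "M = real (card J)"
  have M: "M > 0" using J by (simp add: M_def card_gt_0_iff)
  define q where "q x = (\<Sum>j\<in>J. Q j x) / M" for x
  have q1: "sum q S = 1"
  proof -
    have "sum q S = (\<Sum>j\<in>J. sum (Q j) S) / M"
      unfolding q_def by (subst sum.swap) (simp add: sum_divide_distrib)
    then show ?thesis using Q M by (simp add: M_def)
  qed
  have "(\<Sum>x\<in>S. (q x)\<^sup>2 / P x) = (\<Sum>x\<in>S. \<Sum>j\<in>J. \<Sum>k\<in>J. Q j x * Q k x / P x / M\<^sup>2)"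
    by (intro sum.cong refl)
      (simp add: q_def power2_eq_square sum_product sum_divide_distrib divide_simps mult_ac)
  also have "\<dots> = (\<Sum>j\<in>J. \<Sum>k\<in>J. \<Sum>x\<in>S. Q j x * Q k x / P x / M\<^sup>2)"
    by (subst sum.swap, rule sum.cong[OF refl], subst sum.swap, rule refl)
  also have "\<dots> = (\<Sum>j\<in>J. \<Sum>k\<in>J. (\<Sum>x\<in>S. Q j x * Q k x / P x)) / M\<^sup>2"
    by (simp add: sum_divide_distrib)
  also have "\<dots> \<le> (\<Sum>j\<in>J. \<Sum>k\<in>J. 1 + (if k = j then R - 1 else 0)) / M\<^sup>2"
  proof (intro divide_right_mono sum_mono)
    fix j k assume "j \<in> J" "k \<in> J"
    then show "(\<Sum>x\<in>S. Q j x * Q k x / P x) \<le> 1 + (if k = j then R - 1 else 0)"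
      using off[of j k] diag[of j] by auto
  qed simp
  also have "\<dots> = (M * M + M * (R - 1)) / M\<^sup>2"
    using J by (simp add: sum.distrib sum.delta M_def algebra_simps)
  also have "\<dots> = 1 + (R - 1) / M"
    using M by (simp add: field_simps power2_eq_square)
  finally have chi: "(\<Sum>x\<in>S. (q x)\<^sup>2 / P x) \<le> 1 + (R - 1) / M" .
  have "(\<Sum>x\<in>S. (P x - q x)\<^sup>2 / P x) = (\<Sum>x\<in>S. (q x)\<^sup>2 / P x - 2 * q x + P x)"
    using P by (intro sum.cong refl) (auto simp: power2_eq_square field_simps dest!: P(1))
  also have "\<dots> \<le> (R - 1) / M"
    using chi q1 P(2) by (simp add: sum.distrib sum_subtractf flip: sum_distrib_left)
  finally have dev: "(\<Sum>x\<in>S. (P x - q x)\<^sup>2 / P x) \<le> (R - 1) / M" .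
  have "(\<Sum>x\<in>S. \<bar>P x - q x\<bar>)\<^sup>2 = (\<Sum>x\<in>S. (\<bar>P x - q x\<bar> / sqrt (P x)) * sqrt (P x))\<^sup>2"
    using P(1) by (intro arg_cong[where f = "\<lambda>t. t\<^sup>2"] sum.cong refl) fastforce
  also have "\<dots> \<le> (\<Sum>x\<in>S. (\<bar>P x - q x\<bar> / sqrt (P x))\<^sup>2) * (\<Sum>x\<in>S. (sqrt (P x))\<^sup>2)"
    by (rule Cauchy_Schwarz_ineq_sum)
  also have "(\<Sum>x\<in>S. (sqrt (P x))\<^sup>2) = 1"
    using P by (simp add: less_imp_le)
  also have "(\<Sum>x\<in>S. (\<bar>P x - q x\<bar> / sqrt (P x))\<^sup>2) = (\<Sum>x\<in>S. (P x - q x)\<^sup>2 / P x)"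
    using P(1) by (intro sum.cong refl) (simp add: power_divide less_imp_le)
  finally have "(\<Sum>x\<in>S. \<bar>P x - q x\<bar>)\<^sup>2 \<le> (R - 1) / M" using dev by simp
  then have tv: "(\<Sum>x\<in>S. \<bar>P x - q x\<bar>) \<le> sqrt ((R - 1) / M)"
    by (rule real_le_rsqrt)
  have "sum P A - sum q A = (\<Sum>x\<in>A. P x - q x)" by (simp add: sum_subtractf)
  also have "\<dots> \<le> (\<Sum>x\<in>A. \<bar>P x - q x\<bar>)" by (intro sum_mono) simp
  also have "\<dots> \<le> (\<Sum>x\<in>S. \<bar>P x - q x\<bar>)" using S A by (intro sum_mono2) auto
  finally have qA: "sum P A - sqrt ((R - 1) / M) \<le> sum q A" using tv by simp
  have "\<exists>j\<in>J. sum q A \<le> sum (Q j) A"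
  proof (rule ccontr)
    assume "\<not> ?thesis"
    then have "(\<Sum>j\<in>J. sum (Q j) A) < (\<Sum>j\<in>J. sum q A)"
      using J by (intro sum_strict_mono[OF J]) (simp add: not_le)
    moreover have "(\<Sum>j\<in>J. sum (Q j) A) = M * sum q A"
      using M unfolding q_def by (subst sum.swap) (simp add: sum_divide_distrib[symmetric])
    ultimately show False by (simp add: M_def)
  qed
  then obtain j where j: "j \<in> J" "sum q A \<le> sum (Q j) A" by blast
  have "sum P (S - A) = 1 - sum P A" using S A P(2) by (simp add: sum_diff)
  then show ?thesis using j qA by (intro bexI[of _ j]) (auto simp: M_def)
qed

lemma sum_PiE_const_prod:
  fixes f :: "'a \<Rightarrow> real"
  assumes "finite I" "finite S"
  shows "(\<Sum>X\<in>I \<rightarrow>\<^sub>E S. \<Prod>i\<in>I. f (X i)) = (sum f S) ^ card I"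
  using prod_sum_PiE[of I "\<lambda>_. S" "\<lambda>_. f"] assms by simp

text \<open>Pairwise overlaps are multiplicative over independent observations: an overlap of at most one stays
  so, and only the diagonal overlaps grow with \<open>n\<close>.\<close>

lemma le_cam_iid_mixture:
  fixes P :: "'a \<Rightarrow> real" and Q :: "'j \<Rightarrow> 'a \<Rightarrow> real"
  assumes S: "finite S" and J: "finite J" "J \<noteq> {}"
    and P: "\<And>x. x \<in> S \<Longrightarrow> P x > 0" "sum P S = 1"
    and Q: "\<And>j. j \<in> J \<Longrightarrow> sum (Q j) S = 1" "\<And>j x. j \<in> J \<Longrightarrow> x \<in> S \<Longrightarrow> Q j x \<ge> 0"
    and off: "\<And>j k. j \<in> J \<Longrightarrow> k \<in> J \<Longrightarrow> j \<noteq> k \<Longrightarrow> (\<Sum>x\<in>S. Q j x * Q k x / P x) \<le> 1"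
    and diag: "\<And>j. j \<in> J \<Longrightarrow> (\<Sum>x\<in>S. Q j x * Q j x / P x) \<le> R"
    and A: "A \<subseteq> {..<n::nat} \<rightarrow>\<^sub>E S"
  shows "\<exists>j\<in>J. 1 - sqrt ((R ^ n - 1) / card J)
     \<le> (\<Sum>X\<in>A. \<Prod>i<n. Q j (X i)) + (\<Sum>X\<in>({..<n} \<rightarrow>\<^sub>E S) - A. \<Prod>i<n. P (X i))"
proof (rule le_cam_mixture)
  have pair: "(\<Sum>X\<in>{..<n} \<rightarrow>\<^sub>E S. (\<Prod>i<n. Q j (X i)) * (\<Prod>i<n. Q k (X i)) / (\<Prod>i<n. P (X i)))
    = (\<Sum>x\<in>S. Q j x * Q k x / P x) ^ n" for j k
    using sum_PiE_const_prod[of "{..<n}" S "\<lambda>x. Q j x * Q k x / P x"] S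
    by (simp add: prod.distrib prod_dividef)
  \<comment> \<open>Nonnegativity is what allows the overlaps to be raised to a power monotonically.\<close>
  have nonneg: "0 \<le> (\<Sum>x\<in>S. Q j x * Q k x / P x)" if "j \<in> J" "k \<in> J" for j k
    using that Q P by (intro sum_nonneg divide_nonneg_pos mult_nonneg_nonneg) auto
  show "finite ({..<n} \<rightarrow>\<^sub>E S)" using S by (simp add: finite_PiE)
  show "0 < (\<Prod>i<n. P (X i))" if "X \<in> {..<n} \<rightarrow>\<^sub>E S" for X
    using that P by (intro prod_pos) auto
  show "(\<Sum>X\<in>{..<n} \<rightarrow>\<^sub>E S. \<Prod>i<n. P (X i)) = 1"
    using S P by (simp add: sum_PiE_const_prod)
  show "(\<Sum>X\<in>{..<n} \<rightarrow>\<^sub>E S. \<Prod>i<n. Q j (X i)) = 1" if "j \<in> J" for j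
    using S Q that by (simp add: sum_PiE_const_prod)
  show "(\<Sum>X\<in>{..<n} \<rightarrow>\<^sub>E S. (\<Prod>i<n. Q j (X i)) * (\<Prod>i<n. Q k (X i)) / (\<Prod>i<n. P (X i))) \<le> 1"
    if "j \<in> J" "k \<in> J" "j \<noteq> k" for j k
    using that nonneg off by (simp add: pair power_le_one)
  show "(\<Sum>X\<in>{..<n} \<rightarrow>\<^sub>E S. (\<Prod>i<n. Q j (X i)) * (\<Prod>i<n. Q j (X i)) / (\<Prod>i<n. P (X i))) \<le> R ^ n"
    if "j \<in> J" for j
    using that nonneg diag by (simp add: pair power_mono)
qed (use J A in auto)

section \<open>Samples as finite sums\<close>

lemma finite_spins [simp]: "finite (spins d)"
  by (simp add: spins_def finite_PiE)

definition ising_prob :: "nat \<Rightarrow> real \<Rightarrow> graph \<Rightarrow> (nat set \<Rightarrow> real) \<Rightarrow> (nat \<Rightarrow> real) \<Rightarrow> real" where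
  "ising_prob d \<theta> G w x = ising_weight \<theta> G w x / (\<Sum>y\<in>spins d. ising_weight \<theta> G w y)"

lemma spins_nonempty: "spins d \<noteq> {}"
  by (auto simp: spins_def PiE_eq_empty_iff)

lemma ising_partition_pos: "0 < (\<Sum>y\<in>spins d. ising_weight \<theta> G w y)"
  using spins_nonempty by (intro sum_pos) (auto simp: ising_weight_def)

lemma ising_prob_pos: "0 < ising_prob d \<theta> G w x"
  unfolding ising_prob_def using ising_partition_pos by (auto simp: ising_weight_def)

lemma sum_ising_prob: "(\<Sum>x\<in>spins d. ising_prob d \<theta> G w x) = 1"
  unfolding ising_prob_def using ising_partition_pos[of \<theta> G w d]
  by (simp flip: sum_divide_distrib)

lemma ising_eq: "ising d \<theta> G w = point_measure (spins d) (\<lambda>x. ennreal (ising_prob d \<theta> G w x))"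
  by (simp add: ising_def ising_prob_def)

lemma space_ising [simp]: "space (ising d \<theta> G w) = spins d"
  by (simp add: ising_eq space_point_measure)

lemma emeasure_ising: "A \<subseteq> spins d \<Longrightarrow> emeasure (ising d \<theta> G w) A = ennreal (\<Sum>x\<in>A. ising_prob d \<theta> G w x)"
  by (simp add: ising_eq emeasure_point_measure_finite less_imp_le[OF ising_prob_pos] finite_subset sum_ennreal)

lemma prob_space_ising: "prob_space (ising d \<theta> G w)"
  by (rule prob_spaceI) (simp add: emeasure_ising sum_ising_prob)

lemma space_ising_sample [simp]: "space (ising_sample n d \<theta> G w) = {..<n} \<rightarrow>\<^sub>E spins d"
  by (simp add: ising_sample_def space_PiM)

lemma prob_space_ising_sample: "prob_space (ising_sample n d \<theta> G w)"
  unfolding ising_sample_def by (intro prob_space_PiM prob_space_ising)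

lemma emeasure_ising_sample:
  assumes A: "A \<subseteq> {..<n} \<rightarrow>\<^sub>E spins d"
  shows "emeasure (ising_sample n d \<theta> G w) A = ennreal (\<Sum>X\<in>A. \<Prod>i<n. ising_prob d \<theta> G w (X i))"
proof -
  interpret product_prob_space "\<lambda>_. ising d \<theta> G w" "{..<n}"
    by (intro product_prob_spaceI prob_space_ising)
  have sing: "emeasure (ising_sample n d \<theta> G w) {X} = ennreal (\<Prod>i<n. ising_prob d \<theta> G w (X i))"
    and meas: "{X} \<in> sets (ising_sample n d \<theta> G w)" if "X \<in> {..<n} \<rightarrow>\<^sub>E spins d" for X
  proof -
    have eq: "{X} = (\<Pi>\<^sub>E i\<in>{..<n}. {X i})"
      using that PiE_singleton[of X "{..<n}"] by (auto simp: PiE_iff)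
    have X: "X i \<in> spins d" if "i < n" for i using \<open>X \<in> _\<close> that by auto
    then have s: "{X i} \<in> sets (ising d \<theta> G w)" if "i < n" for i
      using that by (simp add: ising_eq sets_point_measure)
    show "{X} \<in> sets (ising_sample n d \<theta> G w)"
      unfolding eq ising_sample_def using s by (intro sets_PiM_I_finite) auto
    show "emeasure (ising_sample n d \<theta> G w) {X} = ennreal (\<Prod>i<n. ising_prob d \<theta> G w (X i))"
      unfolding eq ising_sample_def
      using s X by (subst emeasure_PiM) (auto simp: emeasure_ising prod_ennreal less_imp_le[OF ising_prob_pos])
  qed
  have fin: "finite A" using A by (rule finite_subset) (simp add: finite_PiE)
  have "emeasure (ising_sample n d \<theta> G w) A = (\<Sum>X\<in>A. emeasure (ising_sample n d \<theta> G w) {X})"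
    using A meas fin by (intro emeasure_eq_sum_singleton) auto
  also have "\<dots> = (\<Sum>X\<in>A. ennreal (\<Prod>i<n. ising_prob d \<theta> G w (X i)))"
    using A sing by (intro sum.cong) auto
  also have "\<dots> = ennreal (\<Sum>X\<in>A. \<Prod>i<n. ising_prob d \<theta> G w (X i))"
    by (intro sum_ennreal prod_nonneg less_imp_le[OF ising_prob_pos] ballI)
  finally show ?thesis .
qed

lemma minimax_risk_le_1: "minimax_risk (connectivity d) (max_degree_class d s) n d \<theta> \<le> 1"
proof -
  have "(\<lambda>_. 0) \<in> tests n d" by (simp add: tests_def)
  then have "minimax_risk (connectivity d) (max_degree_class d s) n d \<theta>
    \<le> type_I_risk (connectivity d) (max_degree_class d s) n d \<theta> (\<lambda>_. 0)
      + type_II_risk (connectivity d) (max_degree_class d s) n d \<theta> (\<lambda>_. 0)"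
    unfolding minimax_risk_def by (rule INF_lower)
  also have "\<dots> \<le> 0 + 1"
    unfolding type_I_risk_def type_II_risk_def
    by (intro add_mono SUP_least prob_space.emeasure_le_1[OF prob_space_ising_sample]) simp
  finally show ?thesis by simp
qed

section \<open>Sums over sign vectors and the flip symmetry\<close>

definition sign_vectors :: "nat set \<Rightarrow> (nat \<Rightarrow> real) set" where
  "sign_vectors V = V \<rightarrow>\<^sub>E {-1, 1}"

lemma finite_sign_vectors [simp]: "finite V \<Longrightarrow> finite (sign_vectors V)"
  by (simp add: sign_vectors_def finite_PiE)

lemma sign_vectors_cases: "x \<in> sign_vectors V \<Longrightarrow> i \<in> V \<Longrightarrow> x i = -1 \<or> x i = 1"
  by (auto simp: sign_vectors_def PiE_iff)

lemma sum_sign_vectors_split: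
  fixes F :: "(nat \<Rightarrow> real) \<Rightarrow> real"
  assumes "A \<inter> B = {}"
  shows "(\<Sum>x\<in>sign_vectors (A \<union> B). F x) = (\<Sum>z\<in>sign_vectors A. \<Sum>y\<in>sign_vectors B. F (merge A B (z, y)))"
proof -
  have "bij_betw (merge A B) (sign_vectors A \<times> sign_vectors B) (sign_vectors (A \<union> B))"
  proof (rule bij_betw_byWitness[where f' = "\<lambda>x. (restrict x A, restrict x B)"])
    show "\<forall>a\<in>sign_vectors A \<times> sign_vectors B. (restrict (merge A B a) A, restrict (merge A B a) B) = a"
      using assms by (auto simp: sign_vectors_def PiE_restrict)
    show "\<forall>x\<in>sign_vectors (A \<union> B). merge A B (restrict x A, restrict x B) = x"
      by (auto simp: sign_vectors_def PiE_restrict)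
    show "merge A B ` (sign_vectors A \<times> sign_vectors B) \<subseteq> sign_vectors (A \<union> B)"
      using assms by (auto simp: sign_vectors_def PiE_cancel_merge)
    show "(\<lambda>x. (restrict x A, restrict x B)) ` sign_vectors (A \<union> B) \<subseteq> sign_vectors A \<times> sign_vectors B"
      by (auto simp: sign_vectors_def)
  qed
  from sum.reindex_bij_betw[OF this, of F] show ?thesis
    by (simp add: sum.cartesian_product split_beta)
qed

definition flip :: "nat set \<Rightarrow> (nat \<Rightarrow> real) \<Rightarrow> nat \<Rightarrow> real" where
  "flip V x = (\<lambda>i\<in>V. - x i)"

lemma sum_flip:
  fixes F :: "(nat \<Rightarrow> real) \<Rightarrow> real"
  shows "(\<Sum>x\<in>sign_vectors V. F (flip V x)) = (\<Sum>x\<in>sign_vectors V. F x)"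
proof (rule sum.reindex_bij_betw, rule bij_betw_byWitness[where f' = "flip V"])
  show "\<forall>x\<in>sign_vectors V. flip V (flip V x) = x"
    by (auto simp: sign_vectors_def flip_def PiE_iff extensional_def fun_eq_iff)
  then show "\<forall>x\<in>sign_vectors V. flip V (flip V x) = x" .
qed (auto simp: sign_vectors_def flip_def PiE_iff)

text \<open>Averaging the sum with its image under the global flip makes it even in \<open>t\<close>. Consequently the
  orientation of the spin to which the pair \<open>v, v'\<close> is tied has no influence on the sum.\<close>

lemma sum_exp_eq_cosh:
  assumes "v \<in> V" "v' \<in> V" and g: "\<And>y. y \<in> sign_vectors V \<Longrightarrow> g (flip V y) = g y"
  shows "(\<Sum>y\<in>sign_vectors V. g y * exp (t * (y v - y v')))
       = (\<Sum>y\<in>sign_vectors V. g y * cosh (t * (y v - y v')))" (is "?L = ?R")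
proof -
  have "?L = (\<Sum>y\<in>sign_vectors V. g (flip V y) * exp (t * (flip V y v - flip V y v')))"
    by (rule sum_flip[symmetric])
  also have "\<dots> = (\<Sum>y\<in>sign_vectors V. g y * exp (- (t * (y v - y v'))))"
    using assms by (intro sum.cong refl) (simp add: flip_def algebra_simps)
  finally have "2 * ?L = (\<Sum>y\<in>sign_vectors V. g y * exp (t * (y v - y v'))) + \<dots>" by simp
  also have "\<dots> = (\<Sum>y\<in>sign_vectors V. 2 * (g y * cosh (t * (y v - y v'))))"
    unfolding sum.distrib[symmetric] by (intro sum.cong refl) (simp add: cosh_field_def field_simps)
  also have "\<dots> = 2 * ?R" by (simp add: sum_distrib_left)
  finally show ?thesis by simp
qed

definition complete_graph :: "nat set \<Rightarrow> graph" where
  "complete_graph V = {e. e \<subseteq> V \<and> card e = 2}"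

text \<open>The Ising energy when all interactions are positive.\<close>

definition alignment :: "graph \<Rightarrow> (nat \<Rightarrow> real) \<Rightarrow> real" where
  "alignment G x = (\<Sum>e\<in>G. \<Prod>i\<in>e. x i)"

lemma finite_complete_graph [simp]: "finite V \<Longrightarrow> finite (complete_graph V)"
  by (simp add: complete_graph_def)

lemma complete_graph_insert:
  assumes "b \<notin> V"
  shows "complete_graph (insert b V) = complete_graph V \<union> (\<lambda>i. {b, i}) ` V"
proof (intro equalityI subsetI)
  fix e assume "e \<in> complete_graph (insert b V)"
  then obtain x y where "e = {x, y}" "x \<noteq> y" "{x, y} \<subseteq> insert b V"
    by (auto simp: complete_graph_def card_2_iff)
  then show "e \<in> complete_graph V \<union> (\<lambda>i. {b, i}) ` V"
    by (auto simp: complete_graph_def insert_commute)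
next
  fix e assume "e \<in> complete_graph V \<union> (\<lambda>i. {b, i}) ` V"
  then show "e \<in> complete_graph (insert b V)"
    using assms by (auto simp: complete_graph_def card_2_iff)
qed

text \<open>The energy of a clique is a function of the magnetisation alone: squaring it counts every pair twice.\<close>

lemma alignment_complete_graph:
  assumes "finite V" "\<And>i. i \<in> V \<Longrightarrow> x i = -1 \<or> x i = (1::real)"
  shows "2 * alignment (complete_graph V) x = (\<Sum>i\<in>V. x i)\<^sup>2 - card V"
  using assms
proof (induction V)
  case empty
  have "complete_graph {} = {}" by (auto simp: complete_graph_def)
  then show ?case by (simp add: alignment_def)
next
  case (insert b V)
  have "alignment (complete_graph (insert b V)) x
    = alignment (complete_graph V) x + (\<Sum>e\<in>(\<lambda>i. {b, i}) ` V. \<Prod>i\<in>e. x i)"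
    unfolding alignment_def complete_graph_insert[OF insert(2)] using insert
    by (intro sum.union_disjoint) (auto simp: complete_graph_def)
  also have "(\<Sum>e\<in>(\<lambda>i. {b, i}) ` V. \<Prod>i\<in>e. x i) = (\<Sum>i\<in>V. x b * x i)"
  proof -
    have "prod x {b, i} = x b * x i" if "i \<in> V" for i
      using that insert(2) by (cases "i = b") auto
    then show ?thesis by (subst sum.reindex) (auto simp: inj_on_def doubleton_eq_iff)
  qed
  finally have "2 * alignment (complete_graph (insert b V)) x
    = 2 * alignment (complete_graph V) x + 2 * x b * (\<Sum>i\<in>V. x i)"
    by (simp add: sum_distrib_left mult.assoc)
  moreover have "2 * alignment (complete_graph V) x = (\<Sum>i\<in>V. x i)\<^sup>2 - card V"
    using insert by auto
  moreover have "(x b)\<^sup>2 = 1" using insert(4)[of b] by auto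
  ultimately show ?case using insert(1,2) by (simp add: power2_sum)
qed

lemma alignment_flip:
  "alignment (complete_graph V) (flip V x) = alignment (complete_graph V) x"
  unfolding alignment_def
  by (intro sum.cong refl) (auto simp: complete_graph_def card_2_iff flip_def)

lemma sum_sign_vectors_exp:
  assumes "finite V"
  shows "(\<Sum>y\<in>sign_vectors V. exp (- (c * (\<Sum>i\<in>V. 1 - y i) / 2))) = (1 + exp (- c)) ^ card V"
proof -
  have "(\<Sum>y\<in>sign_vectors V. exp (- (c * (\<Sum>i\<in>V. 1 - y i) / 2)))
     = (\<Sum>y\<in>sign_vectors V. \<Prod>i\<in>V. exp (- (c * (1 - y i) / 2)))"
    using assms by (intro sum.cong refl)
      (simp flip: exp_sum add: sum_negf sum_distrib_left sum_divide_distrib)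
  also have "\<dots> = (\<Prod>i\<in>V. \<Sum>a\<in>{-1, 1}. exp (- (c * (1 - a) / 2)))"
    unfolding sign_vectors_def using assms
    by (subst prod_sum_PiE) auto
  finally show ?thesis by (simp add: add.commute)
qed

section \<open>Disagreement in a clique\<close>

text \<open>Relative to a constant configuration, a configuration with magnetisation \<open>S\<close> on \<open>m\<close> vertices has
  weight \<open>exp (- \<theta> (m\<^sup>2 - S\<^sup>2) / 2) \<le> exp (- \<theta> m (m - \<bar>S\<bar>) / 2)\<close>. The last expression is at most the sum
  of its two versions with \<open>S\<close> and \<open>- S\<close> for \<open>\<bar>S\<bar>\<close>, each of which is a product over the vertices, so that both sums
  over all configurations are \<open>(1 + exp (- \<theta> m))\<^sup>m\<close>. A configuration in which \<open>v\<close> and \<open>v'\<close> disagree is not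
  constant, so one may subtract the term of a constant configuration, which is \<open>1\<close>; the two
  constant configurations supply the normalisation.\<close>

lemma clique_disagreement:
  fixes \<theta> :: real
  assumes V: "finite V" "v \<in> V" "v' \<in> V" "v \<noteq> v'" and \<theta>: "\<theta> \<ge> 0"
  defines "g \<equiv> \<lambda>y. exp (\<theta> * alignment (complete_graph V) y)"
  shows "(\<Sum>y\<in>{y \<in> sign_vectors V. y v \<noteq> y v'}. g y)
    \<le> ((1 + exp (- (\<theta> * card V))) ^ card V - 1) * (\<Sum>y\<in>sign_vectors V. g y)"
proof -
  define m where "m = real (card V)"
  define E where "E = exp (\<theta> * (m\<^sup>2 - m) / 2)"
  define D where "D = {y \<in> sign_vectors V. y v \<noteq> y v'}"
  define h where "h y = exp (- (\<theta> * m * (\<Sum>i\<in>V. 1 - y i) / 2))" for y :: "nat \<Rightarrow> real"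
  define one where "one = (\<lambda>i\<in>V. 1::real)"
  have one: "one \<in> sign_vectors V" "flip V one \<in> sign_vectors V" "one \<noteq> flip V one"
    using V by (auto simp: one_def sign_vectors_def flip_def fun_eq_iff)
  have g_eq: "g y = E * exp (- (\<theta> * (m\<^sup>2 - (\<Sum>i\<in>V. y i)\<^sup>2) / 2))" if "y \<in> sign_vectors V" for y
  proof -
    have a: "alignment (complete_graph V) y = ((\<Sum>i\<in>V. y i)\<^sup>2 - m) / 2"
      using alignment_complete_graph[OF V(1), of y] sign_vectors_cases[OF that] by (simp add: m_def)
    show ?thesis
      unfolding g_def a E_def by (simp flip: exp_add add: field_simps)
  qed
  \<comment> \<open>The two terms on the right are the product bounds for positive and for negative magnetisation.\<close>
  have g_le: "g y \<le> E * (h y + h (flip V y))" if y: "y \<in> sign_vectors V" for y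
  proof -
    define S where "S = (\<Sum>i\<in>V. y i)"
    have sum1: "(\<Sum>i\<in>V. 1 - y i) = m - S" by (simp add: sum_subtractf m_def S_def)
    have sum2: "(\<Sum>i\<in>V. 1 - flip V y i) = m + S"
      by (simp add: flip_def sum.distrib m_def S_def)
    have "\<bar>S\<bar> \<le> (\<Sum>i\<in>V. \<bar>y i\<bar>)" unfolding S_def by (rule sum_abs)
    also have "\<dots> = (\<Sum>i\<in>V. 1)" using sign_vectors_cases[OF y] by (intro sum.cong refl) force
    also have "\<dots> = m" by (simp add: m_def)
    finally have S: "\<bar>S\<bar> \<le> m" .
    have "m * (m - \<bar>S\<bar>) \<le> (m + \<bar>S\<bar>) * (m - \<bar>S\<bar>)"
      using S by (intro mult_right_mono) auto
    also have "\<dots> = m\<^sup>2 - S\<^sup>2" by (simp add: power2_eq_square algebra_simps)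
    finally have "\<theta> * (m * (m - \<bar>S\<bar>)) \<le> \<theta> * (m\<^sup>2 - S\<^sup>2)" using \<theta> by (rule mult_left_mono)
    then have "exp (- (\<theta> * (m\<^sup>2 - S\<^sup>2) / 2)) \<le> exp (- (\<theta> * m * (m - \<bar>S\<bar>) / 2))"
      by (simp only: exp_le_cancel_iff mult.assoc)
    also have "\<dots> \<le> h y + h (flip V y)"
      unfolding h_def sum1 sum2 by (cases "S \<ge> 0") simp_all
    finally show ?thesis unfolding g_eq[OF y] S_def
      by (intro mult_left_mono) (auto simp: E_def)
  qed
  have h_one: "h one = 1" "h (flip V (flip V one)) = 1"
    by (auto simp: h_def one_def flip_def intro!: sum.neutral)
  have hsum: "(\<Sum>y\<in>sign_vectors V. h y) = (1 + exp (- (\<theta> * card V))) ^ card V"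
    unfolding h_def using sum_sign_vectors_exp[OF V(1), of "\<theta> * m"] by (simp add: m_def)
  have hflip: "(\<Sum>y\<in>sign_vectors V. h (flip V y)) = (\<Sum>y\<in>sign_vectors V. h y)"
    by (rule sum_flip)
  have D: "D \<subseteq> sign_vectors V - {one}" "D \<subseteq> sign_vectors V - {flip V one}"
    using V by (auto simp: D_def one_def flip_def)
  have d1: "(\<Sum>y\<in>D. h y) \<le> (\<Sum>y\<in>sign_vectors V. h y) - 1"
  proof -
    have "(\<Sum>y\<in>D. h y) \<le> (\<Sum>y\<in>sign_vectors V - {one}. h y)"
      using D V by (intro sum_mono2) (auto simp: h_def)
    also have "\<dots> = (\<Sum>y\<in>sign_vectors V. h y) - 1"
      using V one by (subst sum_diff1) (auto simp: h_one)
    finally show ?thesis .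
  qed
  have d2: "(\<Sum>y\<in>D. h (flip V y)) \<le> (\<Sum>y\<in>sign_vectors V. h y) - 1"
  proof -
    have "(\<Sum>y\<in>D. h (flip V y)) \<le> (\<Sum>y\<in>sign_vectors V - {flip V one}. h (flip V y))"
      using D V by (intro sum_mono2) (auto simp: h_def)
    also have "\<dots> = (\<Sum>y\<in>sign_vectors V. h y) - 1"
      using V one by (subst sum_diff1) (auto simp: h_one hflip)
    finally show ?thesis .
  qed
  define H where "H = (1 + exp (- (\<theta> * card V))) ^ card V - 1"
  have "(\<Sum>y\<in>D. g y) \<le> (\<Sum>y\<in>D. E * (h y + h (flip V y)))"
    using g_le by (intro sum_mono) (auto simp: D_def)
  also have "\<dots> = E * ((\<Sum>y\<in>D. h y) + (\<Sum>y\<in>D. h (flip V y)))"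
    by (simp add: sum_distrib_left sum.distrib distrib_left)
  also have "\<dots> \<le> E * (H + H)"
    using d1 d2 hsum by (intro mult_left_mono add_mono) (auto simp: E_def H_def)
  also have "\<dots> = H * (E + E)" by (simp add: algebra_simps)
  also have "\<dots> = H * (\<Sum>y\<in>{one, flip V one}. g y)"
  proof -
    have "(\<Sum>i\<in>V. one i) = m" "(\<Sum>i\<in>V. flip V one i) = - m" by (auto simp: one_def flip_def m_def)
    then show ?thesis using one by (simp add: g_eq)
  qed
  also have "\<dots> \<le> H * (\<Sum>y\<in>sign_vectors V. g y)"
    using V one by (intro mult_left_mono sum_mono2) (auto simp: g_def H_def)
  finally show ?thesis by (simp add: D_def H_def)
qed

text \<open>The factor by which a link of opposite signs to \<open>v\<close> and \<open>v'\<close> multiplies the partition function of the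
  clique on \<open>V\<close>, in the symmetrised form given by \<open>sum_exp_eq_cosh\<close>.\<close>

definition frustration_ratio :: "real \<Rightarrow> nat set \<Rightarrow> nat \<Rightarrow> nat \<Rightarrow> real" where
  "frustration_ratio \<theta> V v v' =
     (\<Sum>y\<in>sign_vectors V. exp (\<theta> * alignment (complete_graph V) y) * cosh (\<theta> * (y v - y v')))
     / (\<Sum>y\<in>sign_vectors V. exp (\<theta> * alignment (complete_graph V) y))"

lemma clique_partition_pos:
  "finite V \<Longrightarrow> 0 < (\<Sum>y\<in>sign_vectors V. exp (\<theta> * alignment (complete_graph V) y))"
  by (intro sum_pos) (auto simp: sign_vectors_def PiE_eq_empty_iff intro!: finite_PiE)

lemma frustration_ratio_le:
  assumes V: "finite V" "v \<in> V" "v' \<in> V" "v \<noteq> v'" and \<theta>: "\<theta> \<ge> 0"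
  shows "frustration_ratio \<theta> V v v'
    \<le> 1 + (cosh (2 * \<theta>) - 1) * min 1 ((1 + exp (- (\<theta> * card V))) ^ card V - 1)"
proof -
  define g where "g y = exp (\<theta> * alignment (complete_graph V) y)" for y
  define Z where "Z = (\<Sum>y\<in>sign_vectors V. g y)"
  define D where "D = {y \<in> sign_vectors V. y v \<noteq> y v'}"
  have Z: "Z > 0" unfolding Z_def g_def using V by (intro clique_partition_pos)
  have "(\<Sum>y\<in>D. g y) \<le> Z" unfolding Z_def D_def using V by (intro sum_mono2) (auto simp: g_def)
  moreover have "(\<Sum>y\<in>D. g y) \<le> ((1 + exp (- (\<theta> * card V))) ^ card V - 1) * Z"
    unfolding Z_def D_def g_def using clique_disagreement[OF V \<theta>] by simp
  ultimately have D: "(\<Sum>y\<in>D. g y) \<le> min 1 ((1 + exp (- (\<theta> * card V))) ^ card V - 1) * Z"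
    by (simp add: min_def)
  have "(\<Sum>y\<in>sign_vectors V. g y * cosh (\<theta> * (y v - y v')))
    = (\<Sum>y\<in>sign_vectors V. g y + (if y v \<noteq> y v' then g y * (cosh (2 * \<theta>) - 1) else 0))"
  proof (intro sum.cong refl)
    fix y assume y: "y \<in> sign_vectors V"
    show "g y * cosh (\<theta> * (y v - y v')) = g y + (if y v \<noteq> y v' then g y * (cosh (2 * \<theta>) - 1) else 0)"
      using sign_vectors_cases[OF y V(2)] sign_vectors_cases[OF y V(3)]
      by (auto simp: algebra_simps)
  qed
  also have "\<dots> = Z + (cosh (2 * \<theta>) - 1) * (\<Sum>y\<in>D. g y)"
    using V by (simp add: sum.distrib Z_def D_def sum.If_cases Int_def sum_distrib_left mult.commute
        flip: sum.inter_filter)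
  also have "\<dots> \<le> Z + (cosh (2 * \<theta>) - 1) * (min 1 ((1 + exp (- (\<theta> * card V))) ^ card V - 1) * Z)"
    using D cosh_real_ge_1[of "2 * \<theta>"] by (intro add_left_mono mult_left_mono) auto
  finally show ?thesis using Z
    unfolding frustration_ratio_def g_def[symmetric] Z_def[symmetric] by (simp add: field_simps)
qed

lemma frustration_ratio_ge_1:
  assumes "finite V"
  shows "1 \<le> frustration_ratio \<theta> V v v'"
  unfolding frustration_ratio_def using clique_partition_pos[OF assms, of \<theta>]
  by (simp add: le_divide_eq) (auto intro!: sum_mono simp: cosh_real_ge_1)

lemma cosh_le_quadratic:
  fixes u :: real
  assumes "0 \<le> u" "u \<le> 1"
  shows "cosh u \<le> 1 + u\<^sup>2"
proof -
  have "exp u \<le> 1 + u + u\<^sup>2" using assms by (intro exp_bound)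
  moreover have "exp (- u) \<le> 1 - u + u\<^sup>2"
  proof -
    have "1 \<le> (1 - u + u\<^sup>2) * (1 + u + u\<^sup>2 / 2)"
    proof -
      have "(1 - u + u\<^sup>2) * (1 + u + u\<^sup>2 / 2) = 1 + u\<^sup>2 / 2 + u ^ 3 / 2 + u ^ 4 / 2"
        by (simp add: field_simps power2_eq_square power3_eq_cube power4_eq_xxxx)
      then show ?thesis using assms by simp
    qed
    also have "\<dots> \<le> (1 - u + u\<^sup>2) * exp u"
      using assms exp_lower_Taylor_quadratic[of u] by (intro mult_left_mono) auto
    finally show ?thesis by (simp add: exp_minus field_simps)
  qed
  ultimately show ?thesis by (simp add: cosh_field_def)
qed

text \<open>The cases \<open>\<theta> s \<le> 2 ln s\<close> and \<open>\<theta> s > 2 ln s\<close> use the two arguments of the minimum in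
  \<open>frustration_ratio_le\<close>. In the first case \<open>exp (- \<theta> (s - 16) / 2) \<ge> 1 / s\<close>, whereas \<open>r - 1\<close> is of
  order \<open>(ln s / s)\<^sup>2\<close>. In the second case \<open>r - 1 \<le> 2 s exp (- \<theta> (s - 3))\<close>, and half of the exponent
  pays for the factor \<open>s\<close>.\<close>

lemma chi_square_of_link:
  assumes V: "finite V" "v \<in> V" "v' \<in> V" "v \<noteq> v'" and \<theta>: "\<theta> \<ge> 0"
    and card: "card V = s - 1"
    and s: "s \<ge> 64" "6 * (ln (real s))\<^sup>2 \<le> real s" "4 * ln (real s) \<le> real s"
  shows "(frustration_ratio \<theta> V v v')\<^sup>2 \<le> 1 + 8 * exp (- (\<theta> * (real s - 16) / 2))"
proof -
  define r where "r = frustration_ratio \<theta> V v v'"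
  define L where "L = ln (real s)"
  have eL: "exp L = s" using s by (simp add: L_def)
  have L: "L > 0" using s by (simp add: L_def)
  define m where "m = real (card V)"
  have m: "m = real s - 1" using s card by (simp add: m_def of_nat_diff)
  define \<epsilon> where "\<epsilon> = exp (- (\<theta> * (real s - 16) / 2))"
  have r0: "r \<ge> 1" unfolding r_def using V by (intro frustration_ratio_ge_1)
  have c1: "cosh (2 * \<theta>) \<ge> 1" by (rule cosh_real_ge_1)
  have r1: "r \<le> 1 + (cosh (2 * \<theta>) - 1) * min 1 ((1 + exp (- (\<theta> * m))) ^ card V - 1)"
    unfolding r_def m_def by (rule frustration_ratio_le[OF V \<theta>])
  have "r\<^sup>2 \<le> 1 + 8 * \<epsilon>"
  proof (cases "\<theta> * s \<le> 2 * L")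
    case True
    \<comment> \<open>\<open>u\<close> is the largest value of \<open>2 * \<theta>\<close> in this case.\<close>
    define u where "u = 4 * L / s"
    have "2 * \<theta> \<le> u" using True s by (simp add: u_def field_simps)
    moreover have "u \<le> 1" using s by (simp add: u_def L_def)
    ultimately have "cosh (2 * \<theta>) \<le> 1 + (2 * \<theta>)\<^sup>2" "(2 * \<theta>)\<^sup>2 \<le> u\<^sup>2"
      using \<theta> by (intro cosh_le_quadratic power_mono; simp)+
    moreover have "r \<le> 1 + (cosh (2 * \<theta>) - 1) * 1"
      using c1 by (intro order.trans[OF r1] add_left_mono mult_left_mono) auto
    ultimately have "r \<le> 1 + u\<^sup>2" by simp
    moreover have "u\<^sup>2 \<le> 1" using \<open>u \<le> 1\<close> L by (auto simp: u_def intro: power_le_one)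
    moreover from this have "(1 + u\<^sup>2)\<^sup>2 \<le> 1 + 3 * u\<^sup>2"
      using mult_left_mono[of "u\<^sup>2" 1 "u\<^sup>2"] by (simp add: power2_sum power2_eq_square[of "u\<^sup>2"])
    moreover have "r\<^sup>2 \<le> (1 + u\<^sup>2)\<^sup>2"
      using r0 \<open>r \<le> 1 + u\<^sup>2\<close> by (intro power_mono) auto
    ultimately have "r\<^sup>2 \<le> 1 + 3 * u\<^sup>2" by simp
    also have "3 * u\<^sup>2 = 8 * (6 * L\<^sup>2 / s) / s" using s by (simp add: u_def power2_eq_square)
    also have "\<dots> \<le> 8 * 1 / s"
      using s by (intro divide_right_mono mult_left_mono) (auto simp: L_def)
    also have "\<dots> = 8 * exp (- L)" by (simp add: exp_minus eL divide_inverse)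
    also have "\<dots> \<le> 8 * \<epsilon>" using True \<theta> by (simp add: \<epsilon>_def algebra_simps)
    finally show ?thesis by simp
  next
    case False
    define q where "q = exp (- (\<theta> * m))"
    have "m * q \<le> s * exp (- (\<theta> * m))" using m by (simp add: q_def)
    also have "\<dots> = exp (L - \<theta> * m)" by (simp add: eL exp_diff exp_minus divide_inverse)
    finally have mq: "m * q \<le> exp (L - \<theta> * m)" .
    have half: "\<theta> * m \<ge> \<theta> * s / 2" using s \<theta> mult_left_mono[of "real s / 2" m \<theta>] by (simp add: m)
    then have "L - \<theta> * m \<le> 0" using False by simp
    then have "m * q \<le> 1" using mq order.trans by fastforce
    have "(1 + q) ^ card V \<le> exp q ^ card V"
      by (intro power_mono exp_ge_add_one_self) (auto simp: q_def add_nonneg_nonneg)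
    also have "\<dots> = exp (m * q)" by (simp add: m_def exp_of_nat_mult)
    also have "\<dots> \<le> 1 + m * q + (m * q)\<^sup>2"
      using \<open>m * q \<le> 1\<close> m s by (intro exp_bound) (auto simp: q_def)
    also have "(m * q)\<^sup>2 \<le> m * q"
      using \<open>m * q \<le> 1\<close> m s mult_left_mono[of "m * q" 1 "m * q"] by (auto simp: q_def power2_eq_square)
    finally have "(1 + q) ^ card V - 1 \<le> 2 * exp (L - \<theta> * m)" using mq by simp
    then have "r \<le> 1 + (cosh (2 * \<theta>) - 1) * (2 * exp (L - \<theta> * m))"
      unfolding q_def using c1 by (intro order.trans[OF r1] add_left_mono mult_left_mono) auto
    also have "\<dots> \<le> 1 + exp (2 * \<theta>) * (2 * exp (L - \<theta> * m))"
    proof (intro add_left_mono mult_right_mono)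
      have "(a + b) / 2 - 1 \<le> a" if "b \<le> 1" "0 \<le> a" for a b :: real
        using that by (simp add: field_simps)
      moreover have "exp (- (2 * \<theta>)) \<le> 1" using \<theta> by simp
      ultimately show "cosh (2 * \<theta>) - 1 \<le> exp (2 * \<theta>)" unfolding cosh_field_def by simp
    qed simp
    also have "\<dots> = 1 + 2 * exp (2 * \<theta> + (L - \<theta> * m))" by (simp add: exp_add)
    also have "\<dots> \<le> 1 + 2 * \<epsilon>"
    proof -
      have "2 * \<theta> + (L - \<theta> * m) \<le> - (\<theta> * (real s - 16) / 2)"
        using False \<theta> unfolding m right_diff_distrib diff_divide_distrib by linarith
      then show ?thesis by (simp add: \<epsilon>_def)
    qed
    finally have r2: "r \<le> 1 + 2 * \<epsilon>" .
    have \<epsilon>1: "\<epsilon> \<le> 1" "0 \<le> \<epsilon>" using s \<theta> by (auto simp: \<epsilon>_def)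
    have "r\<^sup>2 \<le> (1 + 2 * \<epsilon>)\<^sup>2" using r0 r2 by (intro power_mono) auto
    also have "\<dots> \<le> 1 + 8 * \<epsilon>"
      using mult_left_mono[OF \<epsilon>1] by (simp add: power2_eq_square algebra_simps)
    finally show ?thesis .
  qed
  then show ?thesis by (simp add: r_def \<epsilon>_def)
qed

section \<open>A spine with attached cliques\<close>

text \<open>The spine is \<open>{1..D}\<close>; above it lie \<open>M\<close> consecutive blocks of \<open>m\<close> vertices, block \<open>j\<close> being tied to the spine
  vertex \<open>j + 1\<close>. The bound \<open>M \<le> D\<close> gives every block its own hub, which keeps the degrees on the spine
  bounded.\<close>

locale block_layout =
  fixes D m M d :: nat
  assumes m2: "2 \<le> m" and M_le: "M \<le> D" and D1: "1 \<le> D" and d_eq: "d = D + M * m"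
begin

definition block :: "nat \<Rightarrow> nat set" where "block j = {D + j * m<..D + (j + 1) * m}"
definition hub :: "nat \<Rightarrow> nat" where "hub j = j + 1"
definition port :: "nat \<Rightarrow> nat" where "port j = D + j * m + 1"
definition port' :: "nat \<Rightarrow> nat" where "port' j = D + j * m + 2"
definition spine :: graph where "spine = (\<lambda>i. {i, i + 1}) ` {1..<D}"
definition link :: "nat \<Rightarrow> graph" where "link j = {{hub j, port j}, {hub j, port' j}}"
definition linked :: "nat set \<Rightarrow> graph" where
  "linked L = spine \<union> (\<Union>j<M. complete_graph (block j)) \<union> (\<Union>j\<in>L. link j)"
definition link_signs :: "nat set \<Rightarrow> real" where
  "link_signs = (\<lambda>e\<in>vertex_pairs d. if \<exists>j<M. e = {hub j, port' j} then -1 else 1)"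

lemma finite_block [simp]: "finite (block j)" by (simp add: block_def)
lemma card_block [simp]: "card (block j) = m" by (simp add: block_def)

lemma ports: "port j \<in> block j" "port' j \<in> block j" "port j \<noteq> port' j"
  using m2 by (auto simp: block_def port_def port'_def)

lemma block_gt: "i \<in> block j \<Longrightarrow> D < i"
  by (auto simp: block_def)

lemma block_le: "i \<in> block j \<Longrightarrow> j < M \<Longrightarrow> i \<le> d"
proof -
  assume i: "i \<in> block j" "j < M"
  then have "(j + 1) * m \<le> M * m" by (intro mult_right_mono) auto
  then show "i \<le> d" using i by (auto simp: block_def d_eq)
qed

lemma block_unique: "i \<in> block j \<Longrightarrow> i \<in> block k \<Longrightarrow> j = k"
proof (induction j k rule: linorder_wlog)
  case (le j k)
  show ?case
  proof (rule ccontr)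
    assume "j \<noteq> k"
    then have "(j + 1) * m \<le> k * m" using le by (intro mult_right_mono) auto
    then show False using le by (auto simp: block_def)
  qed
qed metis

lemma hub_range: "j < M \<Longrightarrow> hub j \<in> {1..D}"
  using M_le by (auto simp: hub_def)

lemma vertex_cases:
  assumes "i \<in> {1..d}"
  obtains "i \<in> {1..D}" | j where "j < M" "i \<in> block j"
proof (cases "i \<le> D")
  case True
  then show ?thesis using assms that by auto
next
  case False
  define j where "j = (i - D - 1) div m"
  have "j * m \<le> i - D - 1" "i - D - 1 < (j + 1) * m"
    using m2 dividend_less_div_times[of m "i - D - 1"] by (auto simp: j_def algebra_simps)
  moreover have "i - D - 1 < M * m" using assms False by (auto simp: d_eq)
  then have "j < M" unfolding j_def by (simp add: less_mult_imp_div_less)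
  ultimately show ?thesis using False by (intro that(2)[of j]) (auto simp: block_def)
qed

lemma spine_le: "e \<in> spine \<Longrightarrow> e \<subseteq> {1..D} \<and> card e = 2"
  by (auto simp: spine_def)

lemma linked_pairs: "L \<subseteq> {..<M} \<Longrightarrow> linked L \<subseteq> vertex_pairs d"
proof
  fix e assume L: "L \<subseteq> {..<M}" and "e \<in> linked L"
  then consider "e \<in> spine" | j where "j < M" "e \<in> complete_graph (block j)" | j where "j < M" "e \<in> link j"
    by (auto simp: linked_def)
  then show "e \<in> vertex_pairs d"
  proof cases
    case 1
    then show ?thesis using spine_le[of e] by (auto simp: vertex_pairs_def d_eq)
  next
    case 2
    then show ?thesis using block_gt block_le by (fastforce simp: complete_graph_def vertex_pairs_def)
  next
    case 3
    then show ?thesis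
      using hub_range[of j] block_gt[OF ports(1)[of j]] block_gt[OF ports(2)[of j]]
        block_le[OF ports(1)[of j]] block_le[OF ports(2)[of j]]
      by (auto simp: link_def vertex_pairs_def card_insert_if d_eq)
  qed
qed

lemma linked_graphs: "L \<subseteq> {..<M} \<Longrightarrow> linked L \<in> graphs d"
  using linked_pairs by (auto simp: graphs_def)

text \<open>A spine vertex has at most two neighbours on the spine and two ports; a block vertex sees the other
  \<open>m - 1\<close> vertices of its block and at most its hub.\<close>

lemma degree_linked:
  assumes L: "L \<subseteq> {..<M}" and i: "i \<in> {1..d}"
  shows "degree (linked L) i \<le> max 4 m"
proof -
  have deg: "degree (linked L) i \<le> card N"
    if "finite N" "\<And>e. e \<in> linked L \<Longrightarrow> i \<in> e \<Longrightarrow> e \<in> (\<lambda>k. {i, k}) ` N" for N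
  proof -
    have "degree (linked L) i \<le> card ((\<lambda>k. {i, k}) ` N)"
      unfolding degree_def using that by (intro card_mono) auto
    also have "\<dots> \<le> card N" using that by (intro card_image_le)
    finally show ?thesis .
  qed
  from i show ?thesis
  proof (cases rule: vertex_cases)
    case 1
    have "degree (linked L) i \<le> card {i - 1, i + 1, port (i - 1), port' (i - 1)}"
    proof (rule deg)
      fix e assume e: "e \<in> linked L" "i \<in> e"
      from e consider "e \<in> spine" | j where "j < M" "e \<in> complete_graph (block j)" | j where "j < M" "e \<in> link j"
        using L by (auto simp: linked_def)
      then show "e \<in> (\<lambda>k. {i, k}) ` {i - 1, i + 1, port (i - 1), port' (i - 1)}"
      proof cases
        case 1
        then show ?thesis using e by (auto simp: spine_def insert_commute)
      next
        case (2 j)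
        then show ?thesis using e \<open>i \<in> {1..D}\<close> block_gt[of i j] by (auto simp: complete_graph_def)
      next
        case (3 j)
        then have "i = hub j" using e \<open>i \<in> {1..D}\<close> block_gt[OF ports(1)[of j]] block_gt[OF ports(2)[of j]]
          by (auto simp: link_def)
        then show ?thesis using 3 by (auto simp: link_def hub_def)
      qed
    qed simp
    also have "\<dots> \<le> 4" by (simp add: card_insert_if)
    finally show ?thesis by simp
  next
    case (2 j)
    have "degree (linked L) i \<le> card (insert (hub j) (block j - {i}))"
    proof (rule deg)
      fix e assume e: "e \<in> linked L" "i \<in> e"
      from e consider "e \<in> spine" | k where "k < M" "e \<in> complete_graph (block k)" | k where "k < M" "e \<in> link k"
        using L by (auto simp: linked_def)
      then show "e \<in> (\<lambda>k. {i, k}) ` (insert (hub j) (block j - {i}))"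
      proof cases
        case 1
        then show ?thesis using e spine_le[of e] block_gt[OF 2(2)] by fastforce
      next
        case (2 k)
        then have "k = j" using e \<open>i \<in> block j\<close> by (auto simp: complete_graph_def intro: block_unique)
        with 2 e show ?thesis
          by (auto simp: complete_graph_def card_2_iff)
      next
        case (3 k)
        then have "i = port k \<or> i = port' k"
          using e hub_range[of k] block_gt[OF \<open>i \<in> block j\<close>] by (auto simp: link_def)
        moreover from this have "k = j" using \<open>i \<in> block j\<close> ports block_unique by metis
        ultimately show ?thesis using 3 e hub_range[of k] block_gt[OF \<open>i \<in> block j\<close>]
          by (auto simp: link_def insert_commute)
      qed
    qed simp
    also have "\<dots> \<le> Suc (m - 1)"
      using 2 by (intro order.trans[OF card_insert_le_m1]) (auto simp: card_insert_if)
    finally show ?thesis using m2 by simp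
  qed
qed

lemma linked_max_degree_class:
  assumes "L \<subseteq> {..<M}" "max 4 m \<le> s"
  shows "linked L \<in> max_degree_class d s"
proof -
  have "maxdeg d (linked L) \<le> s"
    unfolding maxdeg_def using D1 order.trans[OF degree_linked[OF assms(1)] assms(2)]
    by (subst Max_le_iff) (auto simp: d_eq)
  then show ?thesis using linked_graphs[OF assms(1)] by (simp add: max_degree_class_def)
qed

lemma connected_all_linked: "connectivity d (linked {..<M}) = 1"
proof -
  define R where "R = {(a, b). {a, b} \<in> linked {..<M}}"
  have "sym R" by (auto simp: R_def sym_def insert_commute)
  then have symR: "sym (R\<^sup>*)" by (rule sym_rtrancl)
  have core: "(1, i) \<in> R\<^sup>*" if "i \<in> {1..D}" for i
  proof -
    have "1 \<le> i" using that by simp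
    then show ?thesis using that
    proof (induction i rule: dec_induct)
      case (step k)
      have "{k, k + 1} \<in> spine" unfolding spine_def using step by (intro image_eqI[of _ _ k]) auto
      then have "(k, Suc k) \<in> R" by (auto simp: R_def linked_def)
      then show ?case using step by (auto intro: rtrancl_into_rtrancl)
    qed simp
  qed
  have "(1, i) \<in> R\<^sup>*" if "i \<in> {1..d}" for i
    using that
  proof (cases rule: vertex_cases)
    case (2 j)
    have "{hub j, port j} \<in> linked {..<M}" using 2 by (auto simp: linked_def link_def)
    then have "(hub j, port j) \<in> R" by (simp add: R_def)
    then have p: "(1, port j) \<in> R\<^sup>*" using core[OF hub_range] 2 by (auto intro: rtrancl_into_rtrancl)
    show ?thesis
    proof (cases "i = port j")
      case False
      then have "{port j, i} \<in> complete_graph (block j)" using 2 ports by (auto simp: complete_graph_def)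
      then have "(port j, i) \<in> R" using 2 by (auto simp: R_def linked_def)
      then show ?thesis using p by (auto intro: rtrancl_into_rtrancl)
    qed (use p in simp)
  qed (use core in simp)
  then have "(u, v) \<in> R\<^sup>*" if "u \<in> {1..d}" "v \<in> {1..d}" for u v
    using that symR by (meson symD rtrancl_trans)
  then show ?thesis by (auto simp: connectivity_def connected_graph_def R_def)
qed

lemma disconnected_unlinked:
  assumes j: "j < M" "j \<notin> L" and L: "L \<subseteq> {..<M}"
  shows "connectivity d (linked L) = 0"
proof -
  define R where "R = {(a, b). {a, b} \<in> linked L}"
  \<comment> \<open>A block without its link is a union of connected components.\<close>
  have closed: "b \<in> block j" if "(a, b) \<in> R" "a \<in> block j" for a b
  proof -
    from that consider "{a, b} \<in> spine" | k where "k < M" "{a, b} \<in> complete_graph (block k)"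
      | k where "k \<in> L" "{a, b} \<in> link k"
      by (auto simp: R_def linked_def)
    then show ?thesis
    proof cases
      case 1
      then show ?thesis using spine_le[of "{a, b}"] block_gt[OF that(2)] by auto
    next
      case (2 k)
      then show ?thesis using that block_unique[of a j k] by (auto simp: complete_graph_def)
    next
      case (3 k)
      then have "a = hub k \<or> a = port k \<or> a = port' k" by (auto simp: link_def doubleton_eq_iff)
      moreover have "a \<noteq> hub k" using 3 L hub_range[of k] block_gt[OF that(2)] by auto
      ultimately have "j = k" using that ports block_unique by metis
      then show ?thesis using 3 j by simp
    qed
  qed
  have "b \<in> block j" if "(port j, b) \<in> R\<^sup>*" for b
    using that by (induction rule: rtrancl_induct) (auto intro: ports closed)
  then have "(port j, 1) \<notin> R\<^sup>*" using block_gt D1 by fastforce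
  moreover have "port j \<in> {1..d}" "1 \<in> {1..d}"
    using block_gt[OF ports(1), of j] block_le[OF ports(1) j(1)] D1 by (auto simp: d_eq)
  ultimately have "\<not> connected_graph d (linked L)" unfolding connected_graph_def R_def by blast
  then show ?thesis by (simp add: connectivity_def)
qed

lemma link_signs: "link_signs \<in> edge_signs d"
  by (auto simp: link_signs_def edge_signs_def)

section \<open>The partition function and its links\<close>

text \<open>The energy of a link.\<close>

definition tie :: "nat \<Rightarrow> (nat \<Rightarrow> real) \<Rightarrow> real" where
  "tie j x = x (hub j) * (x (port j) - x (port' j))"

lemma hub_ne_port [simp]: "j < M \<Longrightarrow> hub j \<noteq> port k" "j < M \<Longrightarrow> hub j \<noteq> port' k"
  using hub_range[of j] block_gt[OF ports(1), of k] block_gt[OF ports(2), of k] by auto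

text \<open>The edges of the three kinds are disjoint, and only the link edges to a second port are negative.\<close>

lemma energy_linked:
  assumes L: "L \<subseteq> {..<M}"
  shows "(\<Sum>e\<in>linked L. link_signs e * (\<Prod>i\<in>e. x i))
    = alignment spine x + (\<Sum>j<M. alignment (complete_graph (block j)) x) + (\<Sum>j\<in>L. tie j x)"
proof -
  have finL: "finite L" using L finite_subset by blast
  define s where "s e = link_signs e * (\<Prod>i\<in>e. x i)" for e
  have pairs: "e \<in> linked L \<Longrightarrow> e \<in> vertex_pairs d" for e using linked_pairs[OF L] by auto
  have link_meet: "j < M \<Longrightarrow> e \<in> link j \<Longrightarrow> hub j \<in> e \<and> (\<exists>i\<in>e. i \<in> block j)" for e j
    using ports by (auto simp: link_def)
  have spine_s: "s e = (\<Prod>i\<in>e. x i)" if "e \<in> spine" for e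
  proof -
    have "e \<noteq> {hub j, port' j}" if "j < M" for j
      using spine_le[OF \<open>e \<in> spine\<close>] block_gt[OF ports(2)[of j]] by auto
    then show ?thesis using pairs that by (auto simp: s_def link_signs_def linked_def)
  qed
  have clique_s: "s e = (\<Prod>i\<in>e. x i)" if "e \<in> complete_graph (block k)" "k < M" for e k
  proof -
    have "e \<noteq> {hub j, port' j}" if "j < M" for j
      using \<open>e \<in> complete_graph (block k)\<close> block_gt[of "hub j" k] hub_range[OF that]
      by (auto simp: complete_graph_def)
    then show ?thesis using pairs that by (auto simp: s_def link_signs_def linked_def)
  qed
  have link_s: "(\<Sum>e\<in>link j. s e) = tie j x" if "j \<in> L" for j
  proof -
    have j: "j < M" using L that by auto
    have "{hub j, port j} \<noteq> {hub k, port' k}" if "k < M" for k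
    proof
      assume "{hub j, port j} = {hub k, port' k}"
      then have "hub j = hub k" "port j = port' k" using j that by (auto simp: doubleton_eq_iff)
      then show False using ports(3)[of j] by (auto simp: hub_def)
    qed
    moreover have "{hub j, port j} \<in> vertex_pairs d" "{hub j, port' j} \<in> vertex_pairs d"
      using that by (intro pairs; auto simp: linked_def link_def)+
    ultimately have "link_signs {hub j, port j} = 1" "link_signs {hub j, port' j} = -1"
      using j by (auto simp: link_signs_def)
    moreover have "{hub j, port j} \<noteq> {hub j, port' j}" using ports(3)[of j] by (auto simp: doubleton_eq_iff)
    ultimately show ?thesis using j by (simp add: link_def s_def tie_def algebra_simps)
  qed
  have pc: "spine \<inter> (\<Union>j<M. complete_graph (block j)) = {}"
  proof -
    have False if e: "e \<in> spine" "e \<in> complete_graph (block j)" for e j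
    proof -
      have "e \<noteq> {}" using spine_le[OF e(1)] by auto
      then obtain i where "i \<in> e" by blast
      then have "i \<le> D" "i \<in> block j" using spine_le[OF e(1)] e(2) by (auto simp: complete_graph_def)
      then show False using block_gt[of i j] by simp
    qed
    then show ?thesis by blast
  qed
  have pcl: "(spine \<union> (\<Union>j<M. complete_graph (block j))) \<inter> (\<Union>j\<in>L. link j) = {}"
  proof -
    have False if e: "e \<in> link j" "j \<in> L" "e \<in> spine" for e j
    proof -
      obtain i where "i \<in> e" "i \<in> block j" using link_meet[of j e] e L by auto
      then show False using spine_le[OF e(3)] block_gt[of i j] by fastforce
    qed
    moreover have False if e: "e \<in> link j" "j \<in> L" "e \<in> complete_graph (block k)" for e j k
    proof -
      have "j < M" using e L by auto
      moreover from this have "hub j \<in> block k"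
        using link_meet[of j e] e by (auto simp: complete_graph_def)
      ultimately show False using block_gt[of "hub j" k] hub_range[of j] by simp
    qed
    ultimately show ?thesis by blast
  qed
  have cc: "complete_graph (block j) \<inter> complete_graph (block k) = {}" if "j \<noteq> k" for j k
  proof -
    have False if e: "e \<in> complete_graph (block j)" "e \<in> complete_graph (block k)" for e
    proof -
      have "e \<noteq> {}" using e by (auto simp: complete_graph_def)
      then obtain i where "i \<in> e" by blast
      then have "i \<in> block j" "i \<in> block k" using e by (auto simp: complete_graph_def)
      then show False using \<open>j \<noteq> k\<close> block_unique by blast
    qed
    then show ?thesis by blast
  qed
  have ll: "link j \<inter> link k = {}" if "j \<in> L" "k \<in> L" "j \<noteq> k" for j k
    using that L by (auto simp: link_def doubleton_eq_iff) (auto simp: hub_def subset_iff)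
  have "(\<Sum>e\<in>linked L. s e) = (\<Sum>e\<in>spine. s e) + (\<Sum>e\<in>(\<Union>j<M. complete_graph (block j)). s e)
      + (\<Sum>e\<in>(\<Union>j\<in>L. link j). s e)"
    unfolding linked_def using finL pc pcl
    by (subst sum.union_disjoint, simp_all add: spine_def link_def)+
  also have "(\<Sum>e\<in>(\<Union>j<M. complete_graph (block j)). s e) = (\<Sum>j<M. \<Sum>e\<in>complete_graph (block j). s e)"
    using cc by (intro sum.UNION_disjoint) auto
  also have "(\<Sum>e\<in>(\<Union>j\<in>L. link j). s e) = (\<Sum>j\<in>L. \<Sum>e\<in>link j. s e)"
    using finL ll by (intro sum.UNION_disjoint) (auto simp: link_def)
  finally have "(\<Sum>e\<in>linked L. s e)
    = alignment spine x + (\<Sum>j<M. alignment (complete_graph (block j)) x) + (\<Sum>j\<in>L. tie j x)"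
    using spine_s clique_s link_s by (simp add: alignment_def)
  then show ?thesis by (simp add: s_def)
qed

definition weight :: "real \<Rightarrow> nat set \<Rightarrow> (nat \<Rightarrow> real) \<Rightarrow> real" where
  "weight \<theta> L x = ising_weight \<theta> (linked L) link_signs x"

definition partition_sum :: "real \<Rightarrow> nat set \<Rightarrow> real" where
  "partition_sum \<theta> L = (\<Sum>x\<in>spins d. weight \<theta> L x)"

lemma weight_insert:
  assumes "insert j L \<subseteq> {..<M}" "j \<notin> L"
  shows "weight \<theta> (insert j L) x = weight \<theta> L x * exp (\<theta> * tie j x)"
proof -
  define E where "E K = (\<Sum>e\<in>linked K. link_signs e * (\<Prod>i\<in>e. x i))" for K
  have L: "L \<subseteq> {..<M}" using assms by simp
  then have "finite L" by (rule finite_subset) simp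
  then have "(\<Sum>k\<in>insert j L. tie k x) = (\<Sum>k\<in>L. tie k x) + tie j x" using assms by simp
  then have "E (insert j L) = E L + tie j x"
    unfolding E_def by (simp only: energy_linked L assms(1) add.assoc)
  then show ?thesis
    unfolding weight_def ising_weight_def E_def[symmetric] by (simp add: distrib_left exp_add)
qed

lemma alignment_cong: "(\<And>e i. e \<in> G \<Longrightarrow> i \<in> e \<Longrightarrow> x i = y i) \<Longrightarrow> alignment G x = alignment G y"
  by (simp add: alignment_def)

abbreviation ratio :: "real \<Rightarrow> nat \<Rightarrow> real" where
  "ratio \<theta> j \<equiv> frustration_ratio \<theta> (block j) (port j) (port' j)"

text \<open>Without link \<open>j\<close> the weight factorises into a function \<open>f\<close> of the vertices outside block \<open>j\<close> and the weight \<open>g\<close>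
  of the clique on that block. With the outside spins fixed, the hub only orients the tie, so by
  \<open>sum_exp_eq_cosh\<close> the sum over the block is the same constant for either orientation and comes out of the outer sum.
  Allowing \<open>t = - \<theta>\<close> as well covers the square of a likelihood ratio.\<close>

lemma sum_weight_tie:
  assumes j: "j < M" "j \<notin> L" and L: "L \<subseteq> {..<M}" and t: "t = \<theta> \<or> t = - \<theta>"
  shows "(\<Sum>x\<in>spins d. weight \<theta> L x * exp (t * tie j x)) = ratio \<theta> j * partition_sum \<theta> L"
proof -
  define B where "B = block j"
  define A where "A = {1..d} - B"
  define g where "g x = exp (\<theta> * alignment (complete_graph B) x)" for x
  define f where "f x = exp (\<theta> * (alignment spine x + (\<Sum>k\<in>{..<M} - {j}. alignment (complete_graph (block k)) x)
      + (\<Sum>k\<in>L. tie k x)))" for x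
  define C where "C = (\<Sum>y\<in>sign_vectors B. g y * cosh (\<theta> * (y (port j) - y (port' j))))"
  have B: "B \<subseteq> {1..d}"
  proof
    fix i assume "i \<in> B"
    then have "D < i" "i \<le> d" using block_gt[of i j] block_le[of i j] j(1) by (simp_all add: B_def)
    then show "i \<in> {1..d}" by simp
  qed
  have sp: "spins d = sign_vectors (A \<union> B)"
    using B by (simp add: spins_def sign_vectors_def A_def Un_absorb2)
  have AB: "A \<inter> B = {}" by (auto simp: A_def)
  have wfg: "weight \<theta> L x = f x * g x" for x
  proof -
    have "(\<Sum>k<M. alignment (complete_graph (block k)) x) = alignment (complete_graph B) x
        + (\<Sum>k\<in>{..<M} - {j}. alignment (complete_graph (block k)) x)"
      using j by (simp add: B_def sum.remove)
    then show ?thesis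
      by (simp only: weight_def ising_weight_def energy_linked[OF L] f_def g_def
          exp_add[symmetric] distrib_left[symmetric]) (simp only: ac_simps)
  qed
  have core_A: "i \<in> A" if "i \<in> {1..D}" for i
    using that block_gt[of i j] by (auto simp: A_def B_def d_eq)
  have block_A: "i \<in> A" if "i \<in> block k" "k \<noteq> j" "k < M" for i k
    using that block_gt[of i k] block_le[of i k] block_unique[of i j k] by (auto simp: A_def B_def)
  have mA: "merge A B (z, y) i = z i" if "i \<in> A" for z y :: "nat \<Rightarrow> real" and i
    using that by (simp add: merge_def)
  have mB: "merge A B (z, y) i = y i" if "i \<in> B" for z y :: "nat \<Rightarrow> real" and i
    using that AB by (auto simp: merge_def)
  have fm: "f (merge A B (z, y)) = f z" for z y
  proof -
    have "alignment spine (merge A B (z, y)) = alignment spine z"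
      using spine_le by (intro alignment_cong mA core_A) blast
    moreover have "alignment (complete_graph (block k)) (merge A B (z, y)) = alignment (complete_graph (block k)) z"
      if "k \<in> {..<M} - {j}" for k
      using that by (intro alignment_cong mA block_A[of _ k]) (auto simp: complete_graph_def)
    moreover have "tie k (merge A B (z, y)) = tie k z" if "k \<in> L" for k
    proof -
      have "k < M" "k \<noteq> j" using that L j by auto
      then show ?thesis
        unfolding tie_def by (simp add: mA core_A[OF hub_range] block_A[OF ports(1)] block_A[OF ports(2)])
    qed
    ultimately show ?thesis by (simp add: f_def)
  qed
  have gm: "g (merge A B (z, y)) = g y" for z y
    unfolding g_def by (subst alignment_cong[of _ _ y]) (auto simp: complete_graph_def intro!: mB)
  have tm: "tie j (merge A B (z, y)) = z (hub j) * (y (port j) - y (port' j))" for z y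
  proof -
    have "hub j \<in> A" "port j \<in> B" "port' j \<in> B"
      using core_A[OF hub_range[OF j(1)]] ports[of j] by (simp_all add: B_def)
    then show ?thesis by (simp only: tie_def mA mB)
  qed
  have inner: "(\<Sum>y\<in>sign_vectors B. g y * exp (t * z (hub j) * (y (port j) - y (port' j)))) = C"
    if z: "z \<in> sign_vectors A" for z
  proof -
    have "(\<Sum>y\<in>sign_vectors B. g y * exp (t * z (hub j) * (y (port j) - y (port' j))))
      = (\<Sum>y\<in>sign_vectors B. g y * cosh (t * z (hub j) * (y (port j) - y (port' j))))"
      using ports by (intro sum_exp_eq_cosh) (auto simp: B_def g_def alignment_flip)
    also have "\<dots> = C"
    proof -
      have "t * z (hub j) = \<theta> \<or> t * z (hub j) = - \<theta>"
        using sign_vectors_cases[OF z core_A[OF hub_range[OF j(1)]]] t by auto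
      then have "cosh (t * z (hub j) * u) = cosh (\<theta> * u)" for u
        by (elim disjE) (simp_all only: minus_mult_left[symmetric] cosh_minus)
      then show ?thesis by (simp only: C_def)
    qed
    finally show ?thesis .
  qed
  have Zpos: "(\<Sum>y\<in>sign_vectors B. g y) > 0"
    unfolding g_def B_def by (intro clique_partition_pos) simp
  have "(\<Sum>x\<in>spins d. weight \<theta> L x * exp (t * tie j x))
    = (\<Sum>z\<in>sign_vectors A. f z * (\<Sum>y\<in>sign_vectors B. g y * exp (t * z (hub j) * (y (port j) - y (port' j)))))"
    unfolding sp sum_sign_vectors_split[OF AB] by (simp only: wfg fm gm tm sum_distrib_left mult.assoc)
  also have "\<dots> = (\<Sum>z\<in>sign_vectors A. f z) * C"
    unfolding sum_distrib_right by (intro sum.cong refl) (simp only: inner)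
  also have "C = ratio \<theta> j * (\<Sum>y\<in>sign_vectors B. g y)"
    using Zpos by (simp add: frustration_ratio_def flip: B_def g_def C_def)
  also have "(\<Sum>z\<in>sign_vectors A. f z) * (ratio \<theta> j * (\<Sum>y\<in>sign_vectors B. g y))
    = ratio \<theta> j * (\<Sum>z\<in>sign_vectors A. f z * (\<Sum>y\<in>sign_vectors B. g y))"
    by (simp only: sum_distrib_right[symmetric] mult.left_commute)
  also have "(\<Sum>z\<in>sign_vectors A. f z * (\<Sum>y\<in>sign_vectors B. g y)) = partition_sum \<theta> L"
    unfolding partition_sum_def sp sum_sign_vectors_split[OF AB] by (simp only: wfg fm gm sum_distrib_left)
  finally show ?thesis .
qed

lemma partition_sum_insert:
  assumes "insert j L \<subseteq> {..<M}" "j \<notin> L"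
  shows "partition_sum \<theta> (insert j L) = ratio \<theta> j * partition_sum \<theta> L"
proof -
  have "(\<Sum>x\<in>spins d. weight \<theta> L x * exp (\<theta> * tie j x)) = ratio \<theta> j * partition_sum \<theta> L"
    using assms by (intro sum_weight_tie) auto
  then show ?thesis by (simp only: partition_sum_def weight_insert[OF assms])
qed

lemma partition_sum_pos: "partition_sum \<theta> L > 0"
  unfolding partition_sum_def weight_def by (rule ising_partition_pos)

lemma weight_pos: "weight \<theta> L x > 0" by (simp add: weight_def ising_weight_def)

definition law :: "real \<Rightarrow> nat set \<Rightarrow> (nat \<Rightarrow> real) \<Rightarrow> real" where
  "law \<theta> L = ising_prob d \<theta> (linked L) link_signs"

lemma law_eq: "law \<theta> L x = weight \<theta> L x / partition_sum \<theta> L"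
  by (simp add: law_def ising_prob_def weight_def partition_sum_def)

lemma law_pos: "law \<theta> L x > 0"
  by (simp add: law_def ising_prob_pos)

lemma sum_law: "(\<Sum>x\<in>spins d. law \<theta> L x) = 1"
  by (simp add: law_def sum_ising_prob)

text \<open>The product of the two likelihood ratios and the connected law is, up to normalisation, the weight
  with both links removed; its total is one because the links contribute independent factors to the partition function.\<close>

lemma chi_square_off_diagonal:
  assumes "j < M" "k < M" "j \<noteq> k"
  shows "(\<Sum>x\<in>spins d. law \<theta> ({..<M} - {j}) x * law \<theta> ({..<M} - {k}) x / law \<theta> {..<M} x) = 1"
proof -
  define L where "L = {..<M} - {j, k}"
  have sets: "{..<M} - {j} = insert k L" "{..<M} - {k} = insert j L" "{..<M} = insert j (insert k L)"
    "insert j L \<subseteq> {..<M}" "insert k L \<subseteq> {..<M}" "insert j (insert k L) \<subseteq> {..<M}"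
    "j \<notin> L" "k \<notin> L" "j \<notin> insert k L"
    using assms by (auto simp: L_def)
  have W: "weight \<theta> (insert k L) x * weight \<theta> (insert j L) x / weight \<theta> (insert j (insert k L)) x = weight \<theta> L x" for x
    using weight_pos[of \<theta> L x] sets by (simp add: weight_insert)
  have r: "ratio \<theta> j > 0" using frustration_ratio_ge_1[of "block j" \<theta> "port j" "port' j"] by simp
  have Z: "partition_sum \<theta> (insert j L) = ratio \<theta> j * partition_sum \<theta> L"
    "partition_sum \<theta> (insert j (insert k L)) = ratio \<theta> j * partition_sum \<theta> (insert k L)"
    using sets by (auto intro!: partition_sum_insert)
  have "(\<Sum>x\<in>spins d. law \<theta> (insert k L) x * law \<theta> (insert j L) x / law \<theta> (insert j (insert k L)) x)
    = (\<Sum>x\<in>spins d. weight \<theta> L x * (partition_sum \<theta> (insert j (insert k L))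
         / (partition_sum \<theta> (insert k L) * partition_sum \<theta> (insert j L))))"
    by (intro sum.cong refl) (simp only: law_eq W[symmetric], simp)
  also have "\<dots> = 1"
    using r partition_sum_pos[of \<theta> L] partition_sum_pos[of \<theta> "insert k L"]
    unfolding sum_distrib_right[symmetric] partition_sum_def[symmetric] by (simp add: Z)
  finally show ?thesis using sets(1-3) by simp
qed

text \<open>Squaring the likelihood ratio reverses the sign of the link, and a reversed link has the same factor.\<close>

lemma chi_square_diagonal:
  assumes "j < M"
  shows "(\<Sum>x\<in>spins d. law \<theta> ({..<M} - {j}) x * law \<theta> ({..<M} - {j}) x / law \<theta> {..<M} x) = (ratio \<theta> j)\<^sup>2"
proof -
  define L where "L = {..<M} - {j}"
  have L: "{..<M} = insert j L" "insert j L \<subseteq> {..<M}" "j \<notin> L" "L \<subseteq> {..<M}" using assms by (auto simp: L_def)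
  have W: "weight \<theta> L x * weight \<theta> L x / weight \<theta> (insert j L) x = weight \<theta> L x * exp (- \<theta> * tie j x)" for x
    using weight_pos[of \<theta> L x] L by (simp add: weight_insert exp_minus divide_inverse)
  have Z: "partition_sum \<theta> (insert j L) = ratio \<theta> j * partition_sum \<theta> L"
    using L by (intro partition_sum_insert)
  have "(\<Sum>x\<in>spins d. law \<theta> L x * law \<theta> L x / law \<theta> (insert j L) x)
    = (\<Sum>x\<in>spins d. (weight \<theta> L x * exp (- \<theta> * tie j x)) * (partition_sum \<theta> (insert j L)
         / (partition_sum \<theta> L * partition_sum \<theta> L)))"
    by (intro sum.cong refl) (simp only: law_eq W[symmetric], simp)
  also have "\<dots> = ratio \<theta> j * partition_sum \<theta> L * (ratio \<theta> j * partition_sum \<theta> L / (partition_sum \<theta> L * partition_sum \<theta> L))"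
    unfolding sum_distrib_right[symmetric] Z
    using sum_weight_tie[OF assms L(3,4), of "- \<theta>" \<theta>] by simp
  also have "\<dots> = (ratio \<theta> j)\<^sup>2"
    using partition_sum_pos[of \<theta> L] by (simp add: power2_eq_square)
  finally show ?thesis unfolding L(1)[symmetric] unfolding L_def .
qed

section \<open>The lower bound on the risk\<close>

text \<open>The same edge signs serve all graphs, so both suprema are bounded below by the risks at
  \<open>link_signs\<close>.\<close>

lemma minimax_risk_ge:
  assumes M: "1 \<le> M" and s: "max 4 m \<le> s" and R: "\<And>j. j < M \<Longrightarrow> (ratio \<theta> j)\<^sup>2 \<le> R"
  shows "ennreal (1 - sqrt ((R ^ n - 1) / M)) \<le> minimax_risk (connectivity d) (max_degree_class d s) n d \<theta>"
  unfolding minimax_risk_def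
proof (rule INF_greatest)
  fix \<psi> assume \<psi>: "\<psi> \<in> tests n d"
  define S where "S = {..<n} \<rightarrow>\<^sub>E spins d"
  define A where "A = {X \<in> S. \<psi> X = 1}"
  have "\<psi> X \<in> {0, 1}" if "X \<in> S" for X
    using measurable_space[OF \<psi>[unfolded tests_def], of X] that by (simp add: S_def space_PiM)
  then have co: "{X \<in> S. \<psi> X = 0} = S - A" by (force simp: A_def)
  have "\<exists>j\<in>{..<M}. 1 - sqrt ((R ^ n - 1) / card {..<M})
     \<le> (\<Sum>X\<in>A. \<Prod>i<n. law \<theta> ({..<M} - {j}) (X i)) + (\<Sum>X\<in>({..<n} \<rightarrow>\<^sub>E spins d) - A. \<Prod>i<n. law \<theta> {..<M} (X i))"
    using M R by (intro le_cam_iid_mixture)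
      (auto simp: chi_square_off_diagonal chi_square_diagonal law_pos sum_law less_imp_le A_def S_def
        lessThan_empty_iff)
  then obtain j where j: "j < M" and le: "1 - sqrt ((R ^ n - 1) / M)
     \<le> (\<Sum>X\<in>A. \<Prod>i<n. law \<theta> ({..<M} - {j}) (X i)) + (\<Sum>X\<in>S - A. \<Prod>i<n. law \<theta> {..<M} (X i))"
    by (auto simp: S_def)
  have "ennreal (\<Sum>X\<in>A. \<Prod>i<n. law \<theta> ({..<M} - {j}) (X i))
      = emeasure (ising_sample n d \<theta> (linked ({..<M} - {j})) link_signs) A"
    unfolding law_def by (subst emeasure_ising_sample) (auto simp: A_def S_def)
  also have "\<dots> \<le> type_I_risk (connectivity d) (max_degree_class d s) n d \<theta> \<psi>"
    unfolding type_I_risk_def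
    by (rule SUP_upper2[OF link_signs], rule SUP_upper2[of "linked ({..<M} - {j})"])
      (use j s in \<open>auto simp: A_def S_def disconnected_unlinked intro!: linked_graphs linked_max_degree_class\<close>)
  finally have I: "ennreal (\<Sum>X\<in>A. \<Prod>i<n. law \<theta> ({..<M} - {j}) (X i))
    \<le> type_I_risk (connectivity d) (max_degree_class d s) n d \<theta> \<psi>" .
  have "ennreal (\<Sum>X\<in>S - A. \<Prod>i<n. law \<theta> {..<M} (X i))
      = emeasure (ising_sample n d \<theta> (linked {..<M}) link_signs) (S - A)"
    unfolding law_def by (subst emeasure_ising_sample) (auto simp: A_def S_def)
  also have "\<dots> \<le> type_II_risk (connectivity d) (max_degree_class d s) n d \<theta> \<psi>"
    unfolding type_II_risk_def
    by (rule SUP_upper2[OF link_signs], rule SUP_upper2[of "linked {..<M}"])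
      (use s connected_all_linked in \<open>auto simp: co[unfolded S_def] S_def intro!: linked_graphs linked_max_degree_class\<close>)
  finally have II: "ennreal (\<Sum>X\<in>S - A. \<Prod>i<n. law \<theta> {..<M} (X i))
    \<le> type_II_risk (connectivity d) (max_degree_class d s) n d \<theta> \<psi>" .
  have "ennreal (1 - sqrt ((R ^ n - 1) / M))
    \<le> ennreal ((\<Sum>X\<in>A. \<Prod>i<n. law \<theta> ({..<M} - {j}) (X i)) + (\<Sum>X\<in>S - A. \<Prod>i<n. law \<theta> {..<M} (X i)))"
    by (intro ennreal_leI le)
  also have "\<dots> = ennreal (\<Sum>X\<in>A. \<Prod>i<n. law \<theta> ({..<M} - {j}) (X i)) + ennreal (\<Sum>X\<in>S - A. \<Prod>i<n. law \<theta> {..<M} (X i))"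
    by (intro ennreal_plus sum_nonneg prod_nonneg) (auto simp: law_def less_imp_le ising_prob_pos)
  also have "\<dots> \<le> type_I_risk (connectivity d) (max_degree_class d s) n d \<theta> \<psi>
      + type_II_risk (connectivity d) (max_degree_class d s) n d \<theta> \<psi>"
    by (intro add_mono I II)
  finally show "ennreal (1 - sqrt ((R ^ n - 1) / M))
    \<le> type_I_risk (connectivity d) (max_degree_class d s) n d \<theta> \<psi>
      + type_II_risk (connectivity d) (max_degree_class d s) n d \<theta> \<psi>" .
qed

end

text \<open>The two summands dominate the chi-square divergence for \<open>s \<le> sqrt d\<close> and for \<open>s > sqrt d\<close>,
  respectively.\<close>

definition risk_gap :: "real \<Rightarrow> real" where
  "risk_gap d = 2 * d powr (-1/4) + 32 * ln d / sqrt d"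

text \<open>The division by \<open>d div s\<close> pays for \<open>exp y\<close> only if there are many blocks. If \<open>s > sqrt d\<close> there may be
  a single one, but then \<open>y\<close> is small. The bound \<open>s \<ge> 64\<close> makes \<open>exp y \<le> d\<^sup>1\<^sup>/\<^sup>4\<close>.\<close>

lemma exponential_moment_le_gap:
  fixes s d :: nat
  assumes s: "64 \<le> s" "s \<le> d" and d: "16 * ln (real d) \<le> sqrt d"
    and y: "0 \<le> y" "y \<le> 8 * ln (real d * real s) / s"
  shows "(exp y - 1) / (d div s) \<le> risk_gap d"
proof -
  have d1: "1 < real d" "64 \<le> real d" using s by auto
  have lnd: "ln (real d) > 0" using d1 by simp
  have M: "1 \<le> d div s" using s by (simp add: div_greater_zero_iff Suc_leI)
  have "ln (real d * real s) \<le> ln (real d * real d)" using s d1 by (subst ln_le_cancel_iff) auto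
  also have "\<dots> = 2 * ln (real d)" using d1 by (simp add: ln_mult)
  finally have y2: "y \<le> 16 * ln (real d) / s"
    using y(2) s by (intro order.trans[OF y(2)]) (auto simp: field_simps)
  show ?thesis
  proof (cases "real s \<le> sqrt d")
    case True
    have "16 * ln (real d) / s \<le> 16 * ln (real d) / 64" using s lnd by (intro divide_left_mono) auto
    then have "exp y \<le> real d powr (1/4)" using y2 d1 by (simp add: powr_def)
    moreover have "sqrt d / 2 \<le> d div s"
    proof -
      have "sqrt d \<ge> 2" using d1 by (intro real_le_rsqrt) auto
      have "sqrt d = d / sqrt d" using d1 by (simp add: real_div_sqrt)
      also have "\<dots> \<le> d / s" using True s by (intro divide_left_mono) auto
      also have "\<dots> \<le> d div s + 1"
      proof -
        have "d \<le> (d div s + 1) * s" using s dividend_less_div_times[of s d] by simp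
        then have "real d \<le> real ((d div s + 1) * s)" by (rule of_nat_mono)
        then show ?thesis using s by (simp add: divide_le_eq algebra_simps)
      qed
      finally show ?thesis using \<open>sqrt d \<ge> 2\<close> by simp
    qed
    ultimately have "(exp y - 1) / (d div s) \<le> real d powr (1/4) / (sqrt d / 2)"
      using d1 y(1) by (intro frac_le) auto
    also have "\<dots> = 2 * real d powr (-1/4)"
    proof -
      have "sqrt d = real d powr (1/4) * real d powr (1/4)"
        using d1 by (simp add: powr_half_sqrt flip: powr_add)
      then show ?thesis using d1 by (simp add: powr_minus_divide)
    qed
    also have "\<dots> \<le> risk_gap d" using lnd d1 by (simp add: risk_gap_def)
    finally show ?thesis .
  next
    case False
    have "16 * ln (real d) / s \<le> 16 * ln (real d) / sqrt d"
      using False lnd d1 s by (intro divide_left_mono mult_pos_pos) auto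
    with y2 have y3: "y \<le> 16 * ln (real d) / sqrt d" by simp
    also have "\<dots> \<le> 1" using d d1 by simp
    finally have "y \<le> 1" .
    have "(exp y - 1) / (d div s) \<le> (exp y - 1) / 1"
      using M y(1) by (intro divide_left_mono) auto
    also have "\<dots> \<le> y + y\<^sup>2" using exp_bound[OF y(1) \<open>y \<le> 1\<close>] by simp
    also have "\<dots> \<le> 2 * y" using mult_left_mono[OF \<open>y \<le> 1\<close> y(1)] by (simp add: power2_eq_square)
    also have "\<dots> \<le> risk_gap d" using y3 by (simp add: risk_gap_def add_increasing)
    finally show ?thesis .
  qed
qed

text \<open>Blocks of \<open>s - 1\<close> vertices leave room for the link edge within the degree bound \<open>s\<close>; together with its hub each
  block uses \<open>s\<close> vertices, whence \<open>d div s\<close> blocks.\<close>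

lemma minimax_risk_ge_gap:
  fixes s d n :: nat
  assumes s: "64 \<le> s" "s \<le> d" "6 * (ln (real s))\<^sup>2 \<le> real s" "4 * ln (real s) \<le> real s"
    and d: "16 * ln (real d) \<le> sqrt d" and \<theta>: "0 \<le> \<theta>" and \<kappa>: "1 < \<kappa>"
    and n: "1 \<le> n" "\<theta> > 2 * ln (\<kappa> * real s * real n / ln (real d * real s)) / (real s - 16)"
  shows "ennreal (1 - sqrt (risk_gap d)) \<le> minimax_risk (connectivity d) (max_degree_class d s) n d \<theta>"
proof -
  define M where "M = d div s"
  have M: "1 \<le> M" "M * s \<le> d" using s by (simp_all add: M_def div_greater_zero_iff Suc_leI)
  have "M * (s - 1) + M = M * s" using s by (cases s) auto
  interpret block_layout "d - M * (s - 1)" "s - 1" M d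
  proof unfold_locales
    show "2 \<le> s - 1" using s by simp
    show "M \<le> d - M * (s - 1)" "1 \<le> d - M * (s - 1)" "d = d - M * (s - 1) + M * (s - 1)"
      using M \<open>M * (s - 1) + M = M * s\<close> by linarith+
  qed
  define \<epsilon> where "\<epsilon> = exp (- (\<theta> * (real s - 16) / 2))"
  have r: "(ratio \<theta> j)\<^sup>2 \<le> 1 + 8 * \<epsilon>" for j
    unfolding \<epsilon>_def
    by (rule chi_square_of_link[OF finite_block ports \<theta> card_block s(1) s(3) s(4)])
  have ln_pos: "ln (real d * real s) > 0"
    using s by (intro ln_gt_zero) (auto intro: less_1_mult)
  have "ln (\<kappa> * real s * real n / ln (real d * real s)) < \<theta> * (real s - 16) / 2"
    using n s by (simp add: field_simps)
  moreover have "0 < \<kappa> * real s * real n / ln (real d * real s)"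
    using s n \<kappa> ln_pos by simp
  ultimately have "\<kappa> * real s * real n / ln (real d * real s) < exp (\<theta> * (real s - 16) / 2)"
    by (metis exp_less_mono exp_ln)
  then have "\<kappa> * (real s * real n * \<epsilon>) < ln (real d * real s)"
    using ln_pos by (simp add: \<epsilon>_def exp_minus field_simps)
  moreover have "1 * (real s * real n * \<epsilon>) \<le> \<kappa> * (real s * real n * \<epsilon>)"
    using \<kappa> by (intro mult_right_mono) (auto simp: \<epsilon>_def)
  ultimately have ne: "n * (8 * \<epsilon>) \<le> 8 * ln (real d * real s) / s"
    using s by (simp add: field_simps)
  have "(1 + 8 * \<epsilon>) ^ n \<le> exp (8 * \<epsilon>) ^ n"
    by (intro power_mono exp_ge_add_one_self) (auto simp: \<epsilon>_def add_nonneg_nonneg)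
  also have "\<dots> = exp (n * (8 * \<epsilon>))" by (simp add: exp_of_nat_mult)
  finally have "((1 + 8 * \<epsilon>) ^ n - 1) / M \<le> (exp (n * (8 * \<epsilon>)) - 1) / M"
    by (intro divide_right_mono) auto
  also have "\<dots> \<le> risk_gap d"
    unfolding M_def using s d ne by (intro exponential_moment_le_gap) (auto simp: \<epsilon>_def)
  finally have "ennreal (1 - sqrt (risk_gap d)) \<le> ennreal (1 - sqrt (((1 + 8 * \<epsilon>) ^ n - 1) / M))"
    by (intro ennreal_leI) simp
  also have "\<dots> \<le> minimax_risk (connectivity d) (max_degree_class d s) n d \<theta>"
    using M s r by (intro minimax_risk_ge) auto
  finally show ?thesis .
qed

theorem proposition4p3:
  "\<exists>C::nat. \<forall>(d :: nat \<Rightarrow> nat) (s :: nat \<Rightarrow> nat) (\<theta> :: nat \<Rightarrow> real).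
     filterlim d at_top sequentially \<longrightarrow>
     (\<forall>\<^sub>F n in sequentially. C \<le> s n \<and> s n \<le> d n) \<longrightarrow>
     (\<forall>\<^sub>F n in sequentially. \<theta> n \<ge> 3 / (2 * real_of_int \<lfloor>real (s n) / 4\<rfloor> - 2)) \<longrightarrow>
     (\<exists>\<kappa>::real. \<kappa> > 1 \<and> (\<forall>\<^sub>F n in sequentially.
        \<theta> n > 2 * ln (\<kappa> * real (s n) * real n / ln (real (d n) * real (s n))) / (real (s n) - 16))) \<longrightarrow>
     liminf (\<lambda>n. minimax_risk (connectivity (d n)) (max_degree_class (d n) (s n)) n (d n) (\<theta> n)) = 1"
proof -
  have "\<forall>\<^sub>F s in sequentially. 64 \<le> s \<and> 6 * (ln (real s))\<^sup>2 \<le> real s \<and> 4 * ln (real s) \<le> real s"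
    by (intro eventually_conj eventually_ge_at_top) real_asymp+
  then obtain C where C: "\<And>s. C \<le> s \<Longrightarrow> 64 \<le> s \<and> 6 * (ln (real s))\<^sup>2 \<le> real s \<and> 4 * ln (real s) \<le> real s"
    unfolding eventually_sequentially by blast
  show ?thesis
  proof (intro exI[of _ C] allI impI)
    fix d s :: "nat \<Rightarrow> nat" and \<theta> :: "nat \<Rightarrow> real"
    assume d: "filterlim d at_top sequentially"
      and s: "\<forall>\<^sub>F n in sequentially. C \<le> s n \<and> s n \<le> d n"
      and \<theta>: "\<forall>\<^sub>F n in sequentially. \<theta> n \<ge> 3 / (2 * real_of_int \<lfloor>real (s n) / 4\<rfloor> - 2)"
      and "\<exists>\<kappa>::real. \<kappa> > 1 \<and> (\<forall>\<^sub>F n in sequentially.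
        \<theta> n > 2 * ln (\<kappa> * real (s n) * real n / ln (real (d n) * real (s n))) / (real (s n) - 16))"
    then obtain \<kappa> where \<kappa>: "\<kappa> > 1" "\<forall>\<^sub>F n in sequentially.
        \<theta> n > 2 * ln (\<kappa> * real (s n) * real n / ln (real (d n) * real (s n))) / (real (s n) - 16)"
      by blast
    let ?R = "\<lambda>n. minimax_risk (connectivity (d n)) (max_degree_class (d n) (s n)) n (d n) (\<theta> n)"
    have "\<forall>\<^sub>F k :: nat in sequentially. 16 * ln (real k) \<le> sqrt k" by real_asymp
    then have "\<forall>\<^sub>F n in sequentially. 16 * ln (real (d n)) \<le> sqrt (d n)"
      using d by (rule eventually_compose_filterlim)
    moreover have "\<forall>\<^sub>F n in sequentially. (1::nat) \<le> n" by (rule eventually_ge_at_top)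
    ultimately have lower: "\<forall>\<^sub>F n in sequentially. ennreal (1 - sqrt (risk_gap (d n))) \<le> ?R n"
      using s \<theta> \<kappa>(2)
    proof eventually_elim
      case (elim n)
      have "64 \<le> s n" using elim C by blast
      \<comment> \<open>The denominator in the first lower bound on \<open>\<theta>\<close> is positive, hence \<open>\<theta>\<close> is nonnegative.\<close>
      then have "\<lfloor>real (s n) / 4\<rfloor> \<ge> 16" by (simp add: le_floor_iff)
      then have "0 \<le> 3 / (2 * real_of_int \<lfloor>real (s n) / 4\<rfloor> - 2)" by simp
      then have "0 \<le> \<theta> n" using elim by linarith
      moreover have "C \<le> s n" "s n \<le> d n" using elim by simp_all
      ultimately show ?case
        using minimax_risk_ge_gap[of "s n" "d n" "\<theta> n" \<kappa> n] C[of "s n"] elim \<kappa>(1) by simp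
    qed
    have "((\<lambda>k::nat. 1 - sqrt (risk_gap k)) \<longlongrightarrow> 1) sequentially"
      unfolding risk_gap_def by real_asymp
    then have "((\<lambda>n. 1 - sqrt (risk_gap (d n))) \<longlongrightarrow> 1) sequentially"
      using d by (rule filterlim_compose)
    then have "((\<lambda>n. ennreal (1 - sqrt (risk_gap (d n)))) \<longlongrightarrow> ennreal 1) sequentially"
      by (rule tendsto_ennrealI)
    then have "(?R \<longlongrightarrow> 1) sequentially"
      using tendsto_sandwich[OF lower always_eventually[OF allI[OF minimax_risk_le_1]] _ tendsto_const]
      by simp
    then show "liminf ?R = 1" by (intro lim_imp_Liminf) auto
  qed
qed

end
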